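(* For a finite Markov decision process, let $\alpha\in(0,1)$ be an irregular point. Then (a) if both Conditions A and B$_-$ hold at $\alpha$, then there exists $\delta>0$ such that $N^*((\alpha-\delta,\alpha))<\infty$; (b) if both Conditions A and B$_+$ hold at $\alpha$, then there exists $\delta>0$ such that $N^*((\alpha,\alpha+\delta))<\infty$. Here the conditions at $\alpha$ are: Condition A: there exists $K\in\mathbb{N}^+$ such that $D_n(\alpha)=D(\alpha)$ for all $n\ge K$. Condition B$_-$: for all $\phi\in D(\alpha-)$ and $\psi\in D(\alpha)\setminus D(\alpha-)$ there exists $x\in\mathbb{X}$ such that $\sup_{\pi\in\Pi(D(\alpha))}\frac{d}{d\beta}\left(v_\beta^{\phi^\pi}-v_\beta^{\psi^\pi}\right)\Big|_{\beta=\alpha}(x)<0$. Condition B$_+$: for all $\phi\in D(\alpha+)$ and $\psi\in D(\alpha)\setminus D(\alpha+)$ there exists $x\in\mathbb{X}$ such that $\inf_{\pi\in\Pi(D(\alpha))}\frac{d}{d\beta}\left(v_\beta^{\phi^\pi}-v_\beta^{\psi^\pi}\right)\Big|_{\beta=\alpha}(x)>0$.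
   Context: A finite Markov decision process (MDP) has a finite state set $\mathbb{X}=\{x^1,\ldots,x^m\}$, a finite nonempty action set $A(x)$ for each $x\in\mathbb{X}$, real one-step rewards $r(x,a)$, transition probabilities $p(\cdot|x,a)$ on $\mathbb{X}$, and a terminal reward $s:\mathbb{X}\to\mathbb{R}$. $\mathbb{F}$ is the set of decision rules (identified with deterministic policies), i.e. maps $\phi$ on $\mathbb{X}$ with $\phi(x)\in A(x)$. A Markov policy is a sequence $\pi=(\phi_0,\phi_1,\ldots)$ in $\mathbb{F}$. Functions on $\mathbb{X}$ are identified with vectors in $\mathbb{R}^m$. $P(\phi)$ is the stochastic matrix with entries $p(x^j|x^i,\phi(x^i))$ and $r(\phi)(x)=r(x,\phi(x))$. For $\alpha\in[0,1)$ and $\pi=(\phi_0,\phi_1,\ldots)$, $v_\alpha^\pi=\sum_{t=0}^\infty\alpha^tP(\phi_0)\cdots P(\phi_{t-1})r(\phi_t)$, and $v_\alpha^\phi$ is this with $\pi=(\phi,\phi,\ldots)$; $v_\alpha^\pi$ is analytic in $\alpha\in[0,1)$. $V_\alpha(x)=\max_{\phi\in\mathbb{F}}v_\alpha^\phi(x)$; $T_\alpha^\phi V=r(\phi)+\alpha P(\phi)V$; $V_{0,\alpha}=s$, $V_{n,\alpha}(x)=\max_{\phi\in\mathbb{F}}T_\alpha^\phi V_{n-1,\alpha}(x)$ for $n\ge1$. Put $D_n(\alpha)=\{\phi\in\mathbb{F}:V_{n,\alpha}=T_\alpha^\phi V_{n-1,\alpha}\}$ for $n\in\mathbb{N}^+=\{1,2,\ldots\}$,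 $D(\alpha)=\{\phi\in\mathbb{F}:V_\alpha=v_\alpha^\phi\}$, $D(E)=\bigcup_{\alpha\in E}D(\alpha)$ for $E\subset[0,1)$. The turnpike integer $N(\alpha)$ is the smallest positive integer such that $D_n(\alpha)\subset D(\alpha)$ for all $n\ge N(\alpha)$ (it is known to exist), and $N^*(E)=\sup_{\alpha\in E}N(\alpha)$. For $\alpha\in(0,1)$ let $D(\alpha-)=\bigcap_{i\ge1}D((\alpha-\frac1i,\alpha)\cap[0,1))$ and $D(\alpha+)=\bigcap_{i\ge1}D((\alpha,\alpha+\frac1i)\cap[0,1))$. A point $\alpha\in(0,1)$ is irregular if $D(\alpha-)\ne D(\alpha+)$ (break point) or $D(\alpha)\ne D(\alpha-)\cup D(\alpha+)$ (touching point). For $S\subset\mathbb{F}$, $\Pi(S)$ is the set of Markov policies all of whose decision rules belong to $S$. For $\phi\in\mathbb{F}$ and a Markov policy $\pi=(d_0,d_1,\ldots)$, $\phi^\pi:=(\phi,d_0,d_1,\ldots)$. *)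

theory Defs
  imports "HOL-Analysis.Analysis" "HOL-Library.Extended_Nat" "HOL-Library.Extended_Real"
begin

text \<open>
  The state space is a finite type \<open>'x\<close>; functions on it are vectors in \<open>real ^ 'x\<close>.
  \<open>trans_prob M x a y\<close> is the probability $p(y|x,a)$; \<open>reward M x a\<close> and \<open>trans_prob M x a\<close>
  are meaningful only for \<open>a \<in> actions M x\<close>.
\<close>

record ('x, 'a) mdp =
  actions :: "'x \<Rightarrow> 'a set"
  reward :: "'x \<Rightarrow> 'a \<Rightarrow> real"
  trans_prob :: "'x \<Rightarrow> 'a \<Rightarrow> 'x \<Rightarrow> real"
  term_reward :: "'x \<Rightarrow> real"

definition finite_mdp :: "('x::finite, 'a) mdp \<Rightarrow> bool" where
  "finite_mdp M \<longleftrightarrow>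
     (\<forall>x. finite (actions M x) \<and> actions M x \<noteq> {}) \<and>
     (\<forall>x. \<forall>a\<in>actions M x. (\<forall>y. 0 \<le> trans_prob M x a y) \<and> (\<Sum>y\<in>UNIV. trans_prob M x a y) = 1)"

definition dec_rules :: "('x::finite, 'a) mdp \<Rightarrow> ('x \<Rightarrow> 'a) set" where
  "dec_rules M = {\<phi>. \<forall>x. \<phi> x \<in> actions M x}"

definition policies :: "('x \<Rightarrow> 'a) set \<Rightarrow> (nat \<Rightarrow> 'x \<Rightarrow> 'a) set" where
  "policies S = {\<pi>. \<forall>t. \<pi> t \<in> S}"

definition P_mat :: "('x::finite, 'a) mdp \<Rightarrow> ('x \<Rightarrow> 'a) \<Rightarrow> real ^ 'x ^ 'x" where
  "P_mat M \<phi> = (\<chi> x y. trans_prob M x (\<phi> x) y)"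

definition r_vec :: "('x::finite, 'a) mdp \<Rightarrow> ('x \<Rightarrow> 'a) \<Rightarrow> real ^ 'x" where
  "r_vec M \<phi> = (\<chi> x. reward M x (\<phi> x))"

definition s_vec :: "('x::finite, 'a) mdp \<Rightarrow> real ^ 'x" where
  "s_vec M = (\<chi> x. term_reward M x)"

text \<open>\<open>P_prod M \<pi> t\<close> is $P(\phi_0)\cdots P(\phi_{t-1})$ for $\pi = (\phi_0,\phi_1,\ldots)$.\<close>

primrec P_prod :: "('x::finite, 'a) mdp \<Rightarrow> (nat \<Rightarrow> 'x \<Rightarrow> 'a) \<Rightarrow> nat \<Rightarrow> real ^ 'x ^ 'x" where
  "P_prod M \<pi> 0 = mat 1"
| "P_prod M \<pi> (Suc t) = P_prod M \<pi> t ** P_mat M (\<pi> t)"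

definition v :: "('x::finite, 'a) mdp \<Rightarrow> (nat \<Rightarrow> 'x \<Rightarrow> 'a) \<Rightarrow> real \<Rightarrow> real ^ 'x" where
  "v M \<pi> \<alpha> = (\<Sum>t. \<alpha> ^ t *\<^sub>R (P_prod M \<pi> t *v r_vec M (\<pi> t)))"

definition v_stat :: "('x::finite, 'a) mdp \<Rightarrow> ('x \<Rightarrow> 'a) \<Rightarrow> real \<Rightarrow> real ^ 'x" where
  "v_stat M \<phi> \<alpha> = v M (\<lambda>_. \<phi>) \<alpha>"

definition V_opt :: "('x::finite, 'a) mdp \<Rightarrow> real \<Rightarrow> real ^ 'x" where
  "V_opt M \<alpha> = (\<chi> x. Max ((\<lambda>\<phi>. v_stat M \<phi> \<alpha> $ x) ` dec_rules M))"

definition T_op :: "('x::finite, 'a) mdp \<Rightarrow> real \<Rightarrow> ('x \<Rightarrow> 'a) \<Rightarrow> real ^ 'x \<Rightarrow> real ^ 'x" where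
  "T_op M \<alpha> \<phi> V = r_vec M \<phi> + \<alpha> *\<^sub>R (P_mat M \<phi> *v V)"

primrec V_fin :: "('x::finite, 'a) mdp \<Rightarrow> real \<Rightarrow> nat \<Rightarrow> real ^ 'x" where
  "V_fin M \<alpha> 0 = s_vec M"
| "V_fin M \<alpha> (Suc n) = (\<chi> x. Max ((\<lambda>\<phi>. T_op M \<alpha> \<phi> (V_fin M \<alpha> n) $ x) ` dec_rules M))"

text \<open>\<open>D_fin M \<alpha> n\<close> is only meaningful (and only used below) for \<open>n \<ge> 1\<close>.\<close>

definition D_fin :: "('x::finite, 'a) mdp \<Rightarrow> real \<Rightarrow> nat \<Rightarrow> ('x \<Rightarrow> 'a) set" where
  "D_fin M \<alpha> n = {\<phi> \<in> dec_rules M. V_fin M \<alpha> n = T_op M \<alpha> \<phi> (V_fin M \<alpha> (n - 1))}"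

definition D_opt :: "('x::finite, 'a) mdp \<Rightarrow> real \<Rightarrow> ('x \<Rightarrow> 'a) set" where
  "D_opt M \<alpha> = {\<phi> \<in> dec_rules M. V_opt M \<alpha> = v_stat M \<phi> \<alpha>}"

definition D_set :: "('x::finite, 'a) mdp \<Rightarrow> real set \<Rightarrow> ('x \<Rightarrow> 'a) set" where
  "D_set M E = (\<Union>\<alpha>\<in>E. D_opt M \<alpha>)"

definition D_minus :: "('x::finite, 'a) mdp \<Rightarrow> real \<Rightarrow> ('x \<Rightarrow> 'a) set" where
  "D_minus M \<alpha> = (\<Inter>i\<in>{1::nat..}. D_set M ({\<alpha> - 1 / real i <..< \<alpha>} \<inter> {0..<1}))"

definition D_plus :: "('x::finite, 'a) mdp \<Rightarrow> real \<Rightarrow> ('x \<Rightarrow> 'a) set" where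
  "D_plus M \<alpha> = (\<Inter>i\<in>{1::nat..}. D_set M ({\<alpha> <..< \<alpha> + 1 / real i} \<inter> {0..<1}))"

text \<open>For a finite MDP and \<open>0 \<le> \<alpha> < 1\<close> the integer below exists.\<close>

definition turnpike :: "('x::finite, 'a) mdp \<Rightarrow> real \<Rightarrow> nat" where
  "turnpike M \<alpha> = (LEAST N. 1 \<le> N \<and> (\<forall>n\<ge>N. D_fin M \<alpha> n \<subseteq> D_opt M \<alpha>))"

definition turnpike_sup :: "('x::finite, 'a) mdp \<Rightarrow> real set \<Rightarrow> enat" where
  "turnpike_sup M E = (SUP \<alpha>\<in>E. enat (turnpike M \<alpha>))"

definition break_point :: "('x::finite, 'a) mdp \<Rightarrow> real \<Rightarrow> bool" where
  "break_point M \<alpha> \<longleftrightarrow> \<alpha> \<in> {0<..<1} \<and> D_minus M \<alpha> \<noteq> D_plus M \<alpha>"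

definition touching_point :: "('x::finite, 'a) mdp \<Rightarrow> real \<Rightarrow> bool" where
  "touching_point M \<alpha> \<longleftrightarrow> \<alpha> \<in> {0<..<1} \<and> D_opt M \<alpha> \<noteq> D_minus M \<alpha> \<union> D_plus M \<alpha>"

definition irregular :: "('x::finite, 'a) mdp \<Rightarrow> real \<Rightarrow> bool" where
  "irregular M \<alpha> \<longleftrightarrow> break_point M \<alpha> \<or> touching_point M \<alpha>"

definition condition_A :: "('x::finite, 'a) mdp \<Rightarrow> real \<Rightarrow> bool" where
  "condition_A M \<alpha> \<longleftrightarrow> (\<exists>K\<ge>1. \<forall>n\<ge>K. D_fin M \<alpha> n = D_opt M \<alpha>)"

text \<open>
  \<open>case_nat \<phi> \<pi>\<close> is $\phi^\pi = (\phi, d_0, d_1, \ldots)$ for $\pi = (d_0, d_1, \ldots)$.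
  Suprema and infima are taken in the extended reals, so that no boundedness is presupposed.
\<close>

definition dv_diff ::
    "('x::finite, 'a) mdp \<Rightarrow> real \<Rightarrow> ('x \<Rightarrow> 'a) \<Rightarrow> ('x \<Rightarrow> 'a) \<Rightarrow> (nat \<Rightarrow> 'x \<Rightarrow> 'a) \<Rightarrow> real ^ 'x" where
  "dv_diff M \<alpha> \<phi> \<psi> \<pi> =
     vector_derivative (\<lambda>\<beta>. v M (case_nat \<phi> \<pi>) \<beta> - v M (case_nat \<psi> \<pi>) \<beta>) (at \<alpha>)"

definition condition_B_minus :: "('x::finite, 'a) mdp \<Rightarrow> real \<Rightarrow> bool" where
  "condition_B_minus M \<alpha> \<longleftrightarrow>
     (\<forall>\<phi>\<in>D_minus M \<alpha>. \<forall>\<psi>\<in>D_opt M \<alpha> - D_minus M \<alpha>.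
        \<exists>x. (SUP \<pi>\<in>policies (D_opt M \<alpha>). ereal (dv_diff M \<alpha> \<phi> \<psi> \<pi> $ x)) < 0)"

definition condition_B_plus :: "('x::finite, 'a) mdp \<Rightarrow> real \<Rightarrow> bool" where
  "condition_B_plus M \<alpha> \<longleftrightarrow>
     (\<forall>\<phi>\<in>D_plus M \<alpha>. \<forall>\<psi>\<in>D_opt M \<alpha> - D_plus M \<alpha>.
        \<exists>x. (INF \<pi>\<in>policies (D_opt M \<alpha>). ereal (dv_diff M \<alpha> \<phi> \<psi> \<pi> $ x)) > 0)"

end

theory Submission
  imports Defs "HOL-Complex_Analysis.Conformal_Mappings"
begin

text \<open>
  For \<open>\<beta>\<close> near \<open>\<alpha>\<close> and a large horizon, value iteration at \<open>\<beta>\<close> only uses decision rules that are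
  optimal at \<open>\<alpha>\<close>; by Condition A, the finite-horizon optimal policies at \<open>\<beta>\<close> are then also optimal
  for the same horizon at \<open>\<alpha>\<close>. If \<open>\<phi>\<close> is optimal on the given side of \<open>\<alpha>\<close> and \<open>\<psi>\<close> is optimal at
  \<open>\<alpha>\<close> but not on that side, prefixing \<open>\<phi>\<close> or \<open>\<psi>\<close> to such a policy gives the same value at \<open>\<alpha>\<close>,
  and Condition B fixes the sign of the derivative of the difference. Taylor's formula with a
  remainder that is uniform in the horizon then shows that \<open>\<psi>\<close> is not used. What remains are rules
  optimal on the given side of \<open>\<alpha>\<close>; by analyticity these are optimal for all \<open>\<beta>\<close> near \<open>\<alpha>\<close> there.
\<close>

section \<open>Power series with bounded coefficients\<close>

lemma summable_bounded_power_series: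
  fixes z :: "'a::{real_normed_field,banach}"
  assumes "\<And>t. norm (a t) \<le> R" "norm z < 1"
  shows "summable (\<lambda>t. a t * z ^ t)"
proof (rule summable_comparison_test')
  show "summable (\<lambda>t. R * norm z ^ t)"
    using assms(2) by (intro summable_mult summable_geometric) auto
  show "norm (a t * z ^ t) \<le> R * norm z ^ t" if "t \<ge> 0" for t
    by (simp add: norm_mult norm_power assms(1) mult_right_mono)
qed

lemma DERIV_bounded_power_series:
  fixes a :: "nat \<Rightarrow> real"
  assumes "\<And>t. \<bar>a t\<bar> \<le> R" "\<bar>z\<bar> < 1"
  shows "((\<lambda>z. \<Sum>t. a t * z ^ t) has_real_derivative (\<Sum>t. diffs a t * z ^ t)) (at z)"
  by (rule termdiffs_strong'[where K = 1])
     (use assms in \<open>auto intro: summable_bounded_power_series[where R = R]\<close>)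

lemma summable_diffs_bounded_power_series:
  fixes a :: "nat \<Rightarrow> real"
  assumes "\<And>t. \<bar>a t\<bar> \<le> R" "\<bar>z\<bar> < 1"
  shows "summable (\<lambda>t. diffs a t * z ^ t)"
  by (rule termdiff_converges[where K = 1])
     (use assms in \<open>auto intro: summable_bounded_power_series[where R = R]\<close>)

text \<open>Each monomial satisfies a second-order Taylor bound, and these bounds sum to a constant
  \<open>C\<close> that depends only on \<open>\<rho>\<close>. The coefficients are quantified after
  \<open>C\<close> because they will vary with the horizon and with the discount factor.\<close>

lemma power_series_quadratic_remainder:
  fixes \<rho> :: real
  assumes "0 \<le> \<rho>" "\<rho> < 1"
  shows "\<exists>C\<ge>0. \<forall>a R y z. (\<forall>t. \<bar>a t\<bar> \<le> R) \<longrightarrow> \<bar>y\<bar> \<le> \<rho> \<longrightarrow> \<bar>z\<bar> \<le> \<rho> \<longrightarrow>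
    \<bar>(\<Sum>t. a t * y ^ t) - (\<Sum>t. a t * z ^ t) - (y - z) * (\<Sum>t. diffs a t * z ^ t)\<bar>
      \<le> R * C * (y - z)\<^sup>2"
proof -
  \<comment> \<open>The second derivative of the geometric series at \<open>\<rho>\<close>, term by
    term; the truncated subtractions are harmless because the factors vanish for
    \<open>n < 2\<close>.\<close>
  define c where "c = (\<lambda>n. real n * real (n - 1) * \<rho> ^ (n - 2))"
  have "summable (\<lambda>n. diffs (diffs (\<lambda>_. 1)) n * \<rho> ^ n)"
    by (rule termdiff_converges[where K = 1])
       (use assms in \<open>auto intro!: summable_diffs_bounded_power_series[where R = 1]\<close>)
  then have "summable (\<lambda>n. c (n + 2))"
    by (rule summable_cong[THEN iffD1, rotated]) (auto simp: c_def diffs_def mult_ac)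
  then have c: "summable c"
    by (subst (asm) summable_iff_shift)
  have c0: "c n \<ge> 0" for n
    using assms by (auto simp: c_def)
  have "\<bar>(\<Sum>t. a t * y ^ t) - (\<Sum>t. a t * z ^ t) - (y - z) * (\<Sum>t. diffs a t * z ^ t)\<bar>
      \<le> R * suminf c * (y - z)\<^sup>2"
    if a: "\<forall>t. \<bar>a t\<bar> \<le> R" and y: "\<bar>y\<bar> \<le> \<rho>" and z: "\<bar>z\<bar> \<le> \<rho>" for a R y z
  proof -
    define d where "d = (\<lambda>t. a t * y ^ t - a t * z ^ t - (y - z) * (of_nat t * a t * z ^ (t - Suc 0)))"
    have "(\<lambda>t. of_nat t * a t * z ^ (t - Suc 0)) sums (\<Sum>t. diffs a t * z ^ t)"
      by (rule diffs_equiv, rule summable_diffs_bounded_power_series) (use a z assms in auto)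
    then have d: "d sums ((\<Sum>t. a t * y ^ t) - (\<Sum>t. a t * z ^ t) - (y - z) * (\<Sum>t. diffs a t * z ^ t))"
      unfolding d_def
      by (intro sums_diff sums_mult summable_sums summable_bounded_power_series[where R = R])
         (use a y z assms in auto)
    have d_le: "\<bar>d t\<bar> \<le> R * (y - z)\<^sup>2 * c t" for t
    proof (cases "y = z")
      case True
      then show ?thesis by (simp add: d_def)
    next
      case False
      have "R \<ge> 0" using a[rule_format, of 0] by simp
      have "\<bar>(y ^ t - z ^ t) / (y - z) - of_nat t * z ^ (t - Suc 0)\<bar> \<le> c t * \<bar>y - z\<bar>"
        using lemma_termdiff3[of "y - z" z \<rho> t] False y z by (simp add: c_def)
      then have "\<bar>a t * (y - z)\<bar> * \<bar>(y ^ t - z ^ t) / (y - z) - of_nat t * z ^ (t - Suc 0)\<bar>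
          \<le> (R * \<bar>y - z\<bar>) * (c t * \<bar>y - z\<bar>)"
        using a c0[of t] \<open>R \<ge> 0\<close> by (intro mult_mono) (auto simp: abs_mult mult_right_mono)
      moreover have "d t = a t * (y - z) * ((y ^ t - z ^ t) / (y - z) - of_nat t * z ^ (t - Suc 0))"
        using False by (simp add: d_def field_simps)
      ultimately show ?thesis
        by (simp add: abs_mult power2_eq_square mult_ac)
    qed
    have sm: "summable (\<lambda>t. R * (y - z)\<^sup>2 * c t)"
      by (rule summable_mult[OF c])
    have "\<bar>suminf d\<bar> \<le> (\<Sum>t. R * (y - z)\<^sup>2 * c t)"
      using norm_suminf_le[of d, OF _ sm] d_le by simp
    also have "\<dots> = R * suminf c * (y - z)\<^sup>2"
      by (subst suminf_mult[OF c]) (simp add: mult_ac)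
    finally show ?thesis
      using sums_unique[OF d] by simp
  qed
  moreover have "suminf c \<ge> 0"
    by (rule suminf_nonneg[OF c c0])
  ultimately show ?thesis by blast
qed

text \<open>The derivative at \<open>\<rho>\<close> is an absolutely convergent series with a
  majorant common to all coefficient sequences of a given bound, so it is determined up to a small
  error by an initial segment of the coefficients.\<close>

lemma diffs_power_series_tail:
  fixes \<rho> \<epsilon> :: real
  assumes "0 \<le> \<rho>" "\<rho> < 1" "\<epsilon> > 0"
  shows "\<exists>k. \<forall>a b R. (\<forall>t. \<bar>a t\<bar> \<le> R) \<longrightarrow> (\<forall>t. \<bar>b t\<bar> \<le> R) \<longrightarrow> (\<forall>t\<le>k. a t = b t) \<longrightarrow>
    \<bar>(\<Sum>t. diffs a t * \<rho> ^ t) - (\<Sum>t. diffs b t * \<rho> ^ t)\<bar> \<le> R * \<epsilon>"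
proof -
  \<comment> \<open>The factor 2 is there because two sequences bounded by \<open>R\<close> differ
    by at most \<open>2 * R\<close>.\<close>
  have sm: "summable (\<lambda>t. 2 * (diffs (\<lambda>_. 1) t * \<rho> ^ t))"
    using assms by (intro summable_mult summable_diffs_bounded_power_series[where R = 1]) auto
  from suminf_exist_split[OF assms(3) sm] obtain k where
    k: "norm (\<Sum>i. 2 * (diffs (\<lambda>_. 1) (i + k) * \<rho> ^ (i + k))) < \<epsilon>"
    by blast
  have "\<bar>(\<Sum>t. diffs a t * \<rho> ^ t) - (\<Sum>t. diffs b t * \<rho> ^ t)\<bar> \<le> R * \<epsilon>"
    if a: "\<forall>t. \<bar>a t\<bar> \<le> R" and b: "\<forall>t. \<bar>b t\<bar> \<le> R" and ab: "\<forall>t\<le>k. a t = b t" for a b R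
  proof -
    have R: "R \<ge> 0" using a[rule_format, of 0] by simp
    define d where "d = (\<lambda>t. diffs a t * \<rho> ^ t - diffs b t * \<rho> ^ t)"
    have sa: "summable (\<lambda>t. diffs a t * \<rho> ^ t)" and sb: "summable (\<lambda>t. diffs b t * \<rho> ^ t)"
      by (rule summable_diffs_bounded_power_series; use a b assms in auto)+
    then have d: "summable d"
      unfolding d_def by (rule summable_diff)
    \<comment> \<open>\<open>diffs\<close> shifts indices by one: term \<open>t\<close> involves
      coefficient \<open>t + 1\<close>, so agreement up to \<open>k\<close> cancels the terms below
      \<open>k\<close>.\<close>
    have d0: "d t = 0" if "t < k" for t
      using ab that by (simp add: d_def diffs_def)
    have d_le: "norm (d (i + k)) \<le> R * (2 * (diffs (\<lambda>_. 1) (i + k) * \<rho> ^ (i + k)))" for i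
    proof -
      have "\<bar>a (Suc (i + k)) - b (Suc (i + k))\<bar> \<le> 2 * R"
        using a[rule_format, of "Suc (i + k)"] b[rule_format, of "Suc (i + k)"] by linarith
      then have "\<bar>a (Suc (i + k)) - b (Suc (i + k))\<bar> * (real (Suc (i + k)) * \<rho> ^ (i + k))
          \<le> 2 * R * (real (Suc (i + k)) * \<rho> ^ (i + k))"
        using assms by (intro mult_right_mono) auto
      moreover have "d (i + k) = (a (Suc (i + k)) - b (Suc (i + k))) * (real (Suc (i + k)) * \<rho> ^ (i + k))"
        by (simp add: d_def diffs_def algebra_simps)
      moreover have "\<bar>real (Suc (i + k)) * \<rho> ^ (i + k)\<bar> = real (Suc (i + k)) * \<rho> ^ (i + k)"
        using assms by (intro abs_of_nonneg) auto
      ultimately show ?thesis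
        by (simp add: abs_mult diffs_def mult_ac)
    qed
    have sm': "summable (\<lambda>i. 2 * (diffs (\<lambda>_. 1) (i + k) * \<rho> ^ (i + k)))"
      by (rule summable_ignore_initial_segment[OF sm])
    have "suminf d = (\<Sum>i. d (i + k))"
      by (subst suminf_split_initial_segment[OF d, of k]) (simp add: d0)
    also have "\<bar>\<dots>\<bar> \<le> (\<Sum>i. R * (2 * (diffs (\<lambda>_. 1) (i + k) * \<rho> ^ (i + k))))"
      using norm_suminf_le[OF d_le summable_mult[OF sm']] by simp
    also have "\<dots> = R * (\<Sum>i. 2 * (diffs (\<lambda>_. 1) (i + k) * \<rho> ^ (i + k)))"
      by (rule suminf_mult[OF sm'])
    also have "\<dots> \<le> R * \<epsilon>"
      using k R by (intro mult_left_mono) auto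
    finally show ?thesis
      using suminf_diff[OF sa sb] by (simp add: d_def)
  qed
  then show ?thesis by blast
qed

text \<open>The series extends to a holomorphic function on the complex unit disc. If real zeros
  accumulate at \<open>\<alpha>\<close>, the identity theorem makes this extension vanish.\<close>

lemma bounded_power_series_isolated_zeros:
  fixes a :: "nat \<Rightarrow> real"
  assumes a: "\<And>t. \<bar>a t\<bar> \<le> R" and \<alpha>: "\<bar>\<alpha>\<bar> < 1"
  shows "(\<forall>\<beta>. \<bar>\<beta>\<bar> < 1 \<longrightarrow> (\<Sum>t. a t * \<beta> ^ t) = 0) \<or>
    (\<forall>\<^sub>F \<beta> in at \<alpha>. (\<Sum>t. a t * \<beta> ^ t) \<noteq> 0)"
proof -
  define f where "f = (\<lambda>z::complex. \<Sum>t. of_real (a t) * z ^ t)"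
  have sm: "summable (\<lambda>t. complex_of_real (a t) * z ^ t)" if "norm z < 1" for z
    by (rule summable_bounded_power_series[OF _ that, where R = R]) (simp add: a)
  have hol: "f holomorphic_on ball 0 1"
    by (rule power_series_holomorphic[where a = "\<lambda>t. of_real (a t)"])
       (use sm in \<open>auto simp: f_def intro!: summable_sums\<close>)
  have f: "f (of_real \<beta>) = of_real (\<Sum>t. a t * \<beta> ^ t)" if "\<bar>\<beta>\<bar> < 1" for \<beta>
  proof -
    have "summable (\<lambda>t. a t * \<beta> ^ t)"
      by (rule summable_bounded_power_series[where R = R]) (use a that in auto)
    from suminf_of_real[OF this, where 'a = complex] show ?thesis
      by (simp add: f_def)
  qed
  show ?thesis
  proof (rule disjCI)
    assume "\<not> (\<forall>\<^sub>F \<beta> in at \<alpha>. (\<Sum>t. a t * \<beta> ^ t) \<noteq> 0)"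
    then have fr: "\<exists>\<^sub>F \<beta> in at \<alpha>. (\<Sum>t. a t * \<beta> ^ t) = 0"
      by (simp add: frequently_def)
    define U where "U = {z \<in> ball 0 1. f z = 0}"
    have "of_real \<alpha> islimpt U"
      unfolding islimpt_approachable
    proof (intro allI impI)
      fix e :: real assume "e > 0"
      \<comment> \<open>The cap \<open>1 - \<bar>\<alpha>\<bar>\<close> keeps the chosen zero inside
        the unit interval, where \<open>f\<close> agrees with the real series.\<close>
      then have "\<forall>\<^sub>F \<beta> in at \<alpha>. \<beta> \<noteq> \<alpha> \<and> dist \<beta> \<alpha> < min e (1 - \<bar>\<alpha>\<bar>)"
        using \<alpha> unfolding eventually_at by (intro exI[of _ "min e (1 - \<bar>\<alpha>\<bar>)"]) auto
      from frequently_ex[OF frequently_eventually_conj[OF fr this]]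
      obtain \<beta> where \<beta>: "(\<Sum>t. a t * \<beta> ^ t) = 0" "\<beta> \<noteq> \<alpha>" "dist \<beta> \<alpha> < min e (1 - \<bar>\<alpha>\<bar>)"
        by auto
      then have "\<bar>\<beta>\<bar> < 1" by (auto simp: dist_real_def)
      then show "\<exists>z\<in>U. z \<noteq> complex_of_real \<alpha> \<and> dist z (complex_of_real \<alpha>) < e"
        using \<beta> f[of \<beta>] by (intro bexI[of _ "of_real \<beta>"]) (auto simp: U_def)
    qed
    then have zero: "f w = 0" if "w \<in> ball 0 1" for w
      by (rule analytic_continuation[OF hol open_ball connected_ball _ _ _ _ that, rotated 2])
         (use \<alpha> in \<open>auto simp: U_def\<close>)
    show "\<forall>\<beta>. \<bar>\<beta>\<bar> < 1 \<longrightarrow> (\<Sum>t. a t * \<beta> ^ t) = 0"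
    proof (intro allI impI)
      fix \<beta> :: real assume "\<bar>\<beta>\<bar> < 1"
      with zero[of "of_real \<beta>"] f[OF this] show "(\<Sum>t. a t * \<beta> ^ t) = 0"
        by simp
    qed
  qed
qed

text \<open>Unless the series vanishes identically, it has no zeros near \<open>\<alpha>\<close>
  except possibly \<open>\<alpha>\<close> itself; on a one-sided interval the intermediate value
  theorem then forbids a change of sign. This upgrades "frequently" to "eventually".\<close>

lemma bounded_power_series_sign_eventually_constant:
  fixes a :: "nat \<Rightarrow> real"
  assumes a: "\<And>t. \<bar>a t\<bar> \<le> R" and \<alpha>: "\<bar>\<alpha>\<bar> < 1" and S: "convex S" "\<alpha> \<notin> S"
    and fr: "\<exists>\<^sub>F \<beta> in at \<alpha> within S. 0 \<le> (\<Sum>t. a t * \<beta> ^ t)"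
  shows "\<forall>\<^sub>F \<beta> in at \<alpha> within S. 0 \<le> (\<Sum>t. a t * \<beta> ^ t)"
proof -
  define f where "f = (\<lambda>\<beta>. \<Sum>t. a t * \<beta> ^ t)"
  have lt1: "\<forall>\<^sub>F \<beta> in nhds \<alpha>. \<bar>\<beta>\<bar> < 1"
    by (rule order_tendstoD(2)[OF _ \<alpha>]) (intro tendsto_intros filterlim_ident)
  then have lt1': "\<forall>\<^sub>F \<beta> in at \<alpha>. \<bar>\<beta>\<bar> < 1"
    by (simp add: eventually_nhds_conv_at)
  have "(\<forall>\<beta>. \<bar>\<beta>\<bar> < 1 \<longrightarrow> f \<beta> = 0) \<or> (\<forall>\<^sub>F \<beta> in at \<alpha>. f \<beta> \<noteq> 0)"
    using bounded_power_series_isolated_zeros[OF a \<alpha>] by (simp add: f_def)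
  then show ?thesis
  proof
    assume "\<forall>\<beta>. \<bar>\<beta>\<bar> < 1 \<longrightarrow> f \<beta> = 0"
    then show ?thesis
      using lt1 by (simp add: f_def eventually_at_filter eventually_mono)
  next
    assume "\<forall>\<^sub>F \<beta> in at \<alpha>. f \<beta> \<noteq> 0"
    then have "\<forall>\<^sub>F \<beta> in at \<alpha>. f \<beta> \<noteq> 0 \<and> \<bar>\<beta>\<bar> < 1"
      using lt1' by (rule eventually_conj)
    then obtain d where d: "d > 0" "\<And>\<beta>. \<beta> \<noteq> \<alpha> \<Longrightarrow> dist \<beta> \<alpha> < d \<Longrightarrow> f \<beta> \<noteq> 0 \<and> \<bar>\<beta>\<bar> < 1"
      unfolding eventually_at by auto
    \<comment> \<open>A convex set avoiding \<open>\<alpha>\<close>, hence connected and free of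
      zeros of \<open>f\<close>.\<close>
    define I where "I = S \<inter> ball \<alpha> d"
    have I: "f \<beta> \<noteq> 0" "\<bar>\<beta>\<bar> < 1" if "\<beta> \<in> I" for \<beta>
      using that d(2)[of \<beta>] S(2) by (auto simp: I_def dist_commute)
    have evI: "\<forall>\<^sub>F \<beta> in at \<alpha> within S. \<beta> \<in> I"
      using d(1) by (auto simp: I_def eventually_at dist_commute)
    have "continuous_on I f"
    proof (rule continuous_at_imp_continuous_on, rule ballI)
      fix \<beta> assume "\<beta> \<in> I"
      then show "isCont f \<beta>"
        unfolding f_def by (intro DERIV_isCont[OF DERIV_bounded_power_series[OF a]] I(2))
    qed
    moreover have "connected I"
      unfolding I_def by (intro convex_connected convex_Int S(1) convex_ball)
    ultimately have conn: "connected (f ` I)"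
      by (rule connected_continuous_image)
    from frequently_ex[OF frequently_eventually_conj[OF fr evI]]
    obtain \<beta>0 where \<beta>0: "\<beta>0 \<in> I" "0 \<le> f \<beta>0"
      by (auto simp: f_def)
    have "0 \<le> f \<beta>" if "\<beta> \<in> I" for \<beta>
    proof (rule ccontr)
      assume "\<not> 0 \<le> f \<beta>"
      then have "0 \<in> f ` I"
        using connected_contains_Icc[OF conn, of "f \<beta>" "f \<beta>0"] that \<beta>0 by auto
      then show False using I(1) by auto
    qed
    then show ?thesis
      by (intro eventually_mono[OF evI]) (simp add: f_def)
  qed
qed

section \<open>Discounted rewards and the optimality equation\<close>

definition exp_reward :: "('x::finite, 'a) mdp \<Rightarrow> (nat \<Rightarrow> 'x \<Rightarrow> 'a) \<Rightarrow> nat \<Rightarrow> real ^ 'x" where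
  "exp_reward M \<pi> t = P_prod M \<pi> t *v r_vec M (\<pi> t)"

text \<open>Coefficients, in powers of the discount factor, of the \<open>n\<close>-stage reward
  with the terminal reward paid at time \<open>n\<close>. Extending them by zero turns
  finite-horizon values into power series, so that the estimates above apply uniformly in
  \<open>n\<close>.\<close>

definition horizon_coeff ::
    "('x::finite, 'a) mdp \<Rightarrow> (nat \<Rightarrow> 'x \<Rightarrow> 'a) \<Rightarrow> nat \<Rightarrow> nat \<Rightarrow> real ^ 'x" where
  "horizon_coeff M \<pi> n t =
     (if t < n then exp_reward M \<pi> t else if t = n then P_prod M \<pi> n *v s_vec M else 0)"

text \<open>Optimal values are finite maxima; this carries continuity in the discount factor from
  single rules over to them.\<close>

lemma tendsto_Max_image:
  fixes f :: "'a \<Rightarrow> 'b \<Rightarrow> 'c::linorder_topology"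
  assumes "finite A" "A \<noteq> {}" "\<And>a. a \<in> A \<Longrightarrow> (f a \<longlongrightarrow> l a) F"
  shows "((\<lambda>x. Max ((\<lambda>a. f a x) ` A)) \<longlongrightarrow> Max (l ` A)) F"
  using assms
proof (induction rule: finite_ne_induct)
  case (insert a A)
  then have "((\<lambda>x. max (f a x) (Max ((\<lambda>a. f a x) ` A))) \<longlongrightarrow> max (l a) (Max (l ` A))) F"
    by (intro tendsto_max) auto
  with insert show ?case by simp
qed simp

text \<open>\<open>P_prod\<close> grows on the right, whereas prefixing a rule multiplies on the
  left; associativity reconciles the two.\<close>

lemma P_prod_case_nat: "P_prod M (case_nat \<phi> \<pi>) (Suc t) = P_mat M \<phi> ** P_prod M \<pi> t"
proof (induction t)
  case (Suc t)
  then show ?case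
    using matrix_mul_assoc by (metis P_prod.simps(2) nat.case(2))
qed simp

lemma P_prod_cong: "(\<And>i. i < t \<Longrightarrow> \<pi> i = \<pi>' i) \<Longrightarrow> P_prod M \<pi> t = P_prod M \<pi>' t"
  by (induction t) auto

lemma exp_reward_0 [simp]: "exp_reward M \<pi> 0 = r_vec M (\<pi> 0)"
  by (simp add: exp_reward_def)

lemma exp_reward_cong:
  assumes "\<And>i. i \<le> t \<Longrightarrow> \<pi> i = \<pi>' i"
  shows "exp_reward M \<pi> t = exp_reward M \<pi>' t"
  unfolding exp_reward_def using assms P_prod_cong[of t \<pi> \<pi>' M] by simp

lemma exp_reward_case_nat:
  "exp_reward M (case_nat \<phi> \<pi>) (Suc t) = P_mat M \<phi> *v exp_reward M \<pi> t"
  unfolding exp_reward_def P_prod_case_nat by (simp add: matrix_vector_mul_assoc)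

lemma horizon_coeff_case_nat:
  "horizon_coeff M (case_nat \<phi> \<pi>) (Suc n) (Suc t) = P_mat M \<phi> *v horizon_coeff M \<pi> n t"
  unfolding horizon_coeff_def
  by (simp add: exp_reward_case_nat matrix_vector_mul_assoc P_prod_case_nat del: P_prod.simps)

lemma stationary_policies: "\<phi> \<in> S \<Longrightarrow> (\<lambda>_. \<phi>) \<in> policies S"
  by (simp add: policies_def)

lemma case_nat_policies:
  "\<phi> \<in> S \<Longrightarrow> \<pi> \<in> policies S \<Longrightarrow> case_nat \<phi> \<pi> \<in> policies S"
  by (simp add: policies_def split: nat.split)

lemma T_op_nth: "T_op M \<beta> \<phi> V $ x = r_vec M \<phi> $ x + \<beta> * (P_mat M \<phi> *v V) $ x"
  by (simp add: T_op_def)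

lemma T_op_diff: "T_op M \<beta> \<phi> V - T_op M \<beta> \<phi> W = \<beta> *\<^sub>R (P_mat M \<phi> *v (V - W))"
  by (simp add: T_op_def matrix_vector_mult_diff_distrib algebra_simps)

text \<open>Applying \<open>T_op\<close> multiplies by \<open>P_mat M \<phi>\<close>, raises every
  power of \<open>\<beta>\<close> by one and puts the immediate reward at index 0, which is what
  prefixing \<open>\<phi>\<close> does to the coefficients.\<close>

lemma T_op_horizon:
  "T_op M \<beta> \<phi> (\<Sum>t\<le>n. \<beta> ^ t *\<^sub>R horizon_coeff M \<pi> n t) =
     (\<Sum>t\<le>Suc n. \<beta> ^ t *\<^sub>R horizon_coeff M (case_nat \<phi> \<pi>) (Suc n) t)"
proof -
  have "P_mat M \<phi> *v (\<Sum>t\<le>n. \<beta> ^ t *\<^sub>R horizon_coeff M \<pi> n t) =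
      (\<Sum>t\<le>n. \<beta> ^ t *\<^sub>R (P_mat M \<phi> *v horizon_coeff M \<pi> n t))"
    by (simp add: linear_sum[OF matrix_vector_mul_linear] matrix_vector_mult_scaleR)
  then show ?thesis
    unfolding T_op_def
    by (subst sum.atMost_Suc_shift)
       (simp add: horizon_coeff_case_nat scaleR_sum_right horizon_coeff_def[of _ _ _ 0])
qed

text \<open>Row \<open>x\<close> depends on the rule only through its action at \<open>x\<close>;
  this allows statewise maximizers to be glued into one rule.\<close>

lemma T_op_cong_state: "\<phi> x = \<psi> x \<Longrightarrow> T_op M \<beta> \<phi> V $ x = T_op M \<beta> \<psi> V $ x"
  by (simp add: T_op_nth r_vec_def P_mat_def matrix_vector_mult_def)

section \<open>Stochastic matrices and uniform bounds on coefficients\<close>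

context
  fixes M :: "('x::finite, 'a) mdp"
  assumes fin: "finite_mdp M"
begin

lemma finite_dec_rules: "finite (dec_rules M)"
proof -
  have "dec_rules M = PiE UNIV (actions M)"
    by (auto simp: dec_rules_def PiE_def Pi_def)
  then show ?thesis
    using fin by (simp add: finite_mdp_def finite_PiE)
qed

lemma dec_rules_nonempty: "dec_rules M \<noteq> {}"
proof -
  have "(\<lambda>x. SOME a. a \<in> actions M x) \<in> dec_rules M"
    using fin by (auto simp: dec_rules_def finite_mdp_def some_in_eq)
  then show ?thesis by blast
qed

lemma P_mat_mono:
  assumes "\<phi> \<in> dec_rules M" "\<And>y. V $ y \<le> W $ y"
  shows "(P_mat M \<phi> *v V) $ x \<le> (P_mat M \<phi> *v W) $ x"
  using assms fin
  by (auto simp: matrix_vector_mult_def P_mat_def dec_rules_def finite_mdp_def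
      intro!: sum_mono mult_left_mono)

lemma P_mat_const:
  assumes "\<phi> \<in> dec_rules M"
  shows "(P_mat M \<phi> *v (\<chi> y. c)) $ x = c"
proof -
  have "(P_mat M \<phi> *v (\<chi> y. c)) $ x = (\<Sum>y\<in>UNIV. trans_prob M x (\<phi> x) y) * c"
    by (simp add: matrix_vector_mult_def P_mat_def sum_distrib_right)
  then show ?thesis
    using assms fin by (simp add: dec_rules_def finite_mdp_def)
qed

lemma P_mat_le_const:
  assumes "\<phi> \<in> dec_rules M" "\<And>y. V $ y \<le> c"
  shows "(P_mat M \<phi> *v V) $ x \<le> c"
  using P_mat_mono[OF assms(1), of V "\<chi> y. c" x] assms P_mat_const[of \<phi> c x] by simp

lemma P_mat_ge_const:
  assumes "\<phi> \<in> dec_rules M" "\<And>y. c \<le> V $ y"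
  shows "c \<le> (P_mat M \<phi> *v V) $ x"
  using P_mat_mono[OF assms(1), of "\<chi> y. c" V x] assms P_mat_const[of \<phi> c x] by simp

lemma P_mat_abs_le:
  assumes "\<phi> \<in> dec_rules M" "\<And>y. \<bar>V $ y\<bar> \<le> c"
  shows "\<bar>(P_mat M \<phi> *v V) $ x\<bar> \<le> c"
  using P_mat_le_const[OF assms(1), of V c x] P_mat_ge_const[OF assms(1), of "-c" V x] assms(2)
  by (auto simp: abs_le_iff minus_le_iff)

lemma P_prod_abs_le:
  assumes "\<And>i. \<pi> i \<in> dec_rules M" "\<And>y. \<bar>V $ y\<bar> \<le> c"
  shows "\<bar>(P_prod M \<pi> t *v V) $ x\<bar> \<le> c"
  using assms(2)
\<comment> \<open>The newest matrix stands next to the vector and is absorbed into it, so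
  \<open>V\<close> must be general.\<close>
proof (induction t arbitrary: V)
  case (Suc t)
  show ?case
    using Suc.IH[of "P_mat M (\<pi> t) *v V"] P_mat_abs_le[OF assms(1) Suc.prems]
    by (simp add: matrix_vector_mul_assoc)
qed simp

lemma rewards_bounded:
  "\<exists>R\<ge>0. (\<forall>\<phi>\<in>dec_rules M. \<forall>x. \<bar>r_vec M \<phi> $ x\<bar> \<le> R) \<and> (\<forall>x. \<bar>s_vec M $ x\<bar> \<le> R)"
proof -
  define A where "A = (\<Union>x. (\<lambda>\<phi>. \<bar>r_vec M \<phi> $ x\<bar>) ` dec_rules M \<union> {\<bar>s_vec M $ x\<bar>})"
  have A: "finite A" unfolding A_def using finite_dec_rules by simp
  have s: "\<bar>s_vec M $ x\<bar> \<le> Max A" for x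
    using A by (rule Max_ge) (auto simp: A_def)
  have r: "\<bar>r_vec M \<phi> $ x\<bar> \<le> Max A" if "\<phi> \<in> dec_rules M" for \<phi> x
    using A by (rule Max_ge) (use that in \<open>auto simp: A_def\<close>)
  have "Max A \<ge> 0"
    using s[of undefined] by linarith
  with r s show ?thesis by blast
qed

text \<open>Stochastic matrices do not increase the maximum norm, so one bound on the finitely many
  rewards serves all policies, times and horizons.\<close>

lemma coefficients_bounded:
  "\<exists>R\<ge>0. \<forall>\<pi>\<in>policies (dec_rules M). \<forall>t x.
     \<bar>exp_reward M \<pi> t $ x\<bar> \<le> R \<and> (\<forall>n. \<bar>horizon_coeff M \<pi> n t $ x\<bar> \<le> R)"
proof -
  obtain R where R: "R \<ge> 0" "\<And>\<phi> x. \<phi> \<in> dec_rules M \<Longrightarrow> \<bar>r_vec M \<phi> $ x\<bar> \<le> R"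
    "\<And>x. \<bar>s_vec M $ x\<bar> \<le> R"
    using rewards_bounded by blast
  have e: "\<bar>exp_reward M \<pi> t $ x\<bar> \<le> R" if "\<pi> \<in> policies (dec_rules M)" for \<pi> t x
    unfolding exp_reward_def using that by (intro P_prod_abs_le R(2)) (auto simp: policies_def)
  have "\<bar>horizon_coeff M \<pi> n t $ x\<bar> \<le> R" if "\<pi> \<in> policies (dec_rules M)" for \<pi> n t x
  proof -
    have "\<bar>(P_prod M \<pi> n *v s_vec M) $ x\<bar> \<le> R"
      using that by (intro P_prod_abs_le R(3)) (auto simp: policies_def)
    then show ?thesis
      using e[OF that] R(1) by (simp add: horizon_coeff_def)
  qed
  with R(1) e show ?thesis by blast
qed

section \<open>Discounted values, comparison with fixed points, and optimality\<close>

lemma v_sums: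
  assumes "\<pi> \<in> policies (dec_rules M)" "\<bar>\<beta>\<bar> < 1"
  shows "(\<lambda>t. \<beta> ^ t *\<^sub>R exp_reward M \<pi> t) sums v M \<pi> \<beta>"
proof -
  obtain R where R: "\<And>t x. \<bar>exp_reward M \<pi> t $ x\<bar> \<le> R"
    using coefficients_bounded assms(1) by blast
  have "(\<lambda>t. exp_reward M \<pi> t $ x * \<beta> ^ t) sums (\<Sum>t. exp_reward M \<pi> t $ x * \<beta> ^ t)" for x
    using R assms(2) by (intro summable_sums summable_bounded_power_series[where R = R]) auto
  then have "(\<lambda>t. \<beta> ^ t *\<^sub>R exp_reward M \<pi> t) sums (\<chi> x. \<Sum>t. exp_reward M \<pi> t $ x * \<beta> ^ t)"
    unfolding sums_def by (intro vec_tendstoI) (simp add: mult.commute)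
  then show ?thesis
    unfolding v_def exp_reward_def by (rule summable_sums[OF sums_summable])
qed

lemma v_nth:
  assumes "\<pi> \<in> policies (dec_rules M)" "\<bar>\<beta>\<bar> < 1"
  shows "v M \<pi> \<beta> $ x = (\<Sum>t. exp_reward M \<pi> t $ x * \<beta> ^ t)"
  using sums_unique[OF sums_vec_nth[OF v_sums[OF assms], where i = x]]
  by (simp add: mult.commute)

lemma v_case_nat:
  assumes "\<pi> \<in> policies (dec_rules M)" "\<phi> \<in> dec_rules M" "\<bar>\<beta>\<bar> < 1"
  shows "v M (case_nat \<phi> \<pi>) \<beta> = T_op M \<beta> \<phi> (v M \<pi> \<beta>)"
proof -
  have 1: "(\<lambda>t. \<beta> ^ t *\<^sub>R exp_reward M (case_nat \<phi> \<pi>) t) sums v M (case_nat \<phi> \<pi>) \<beta>"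
    by (intro v_sums case_nat_policies assms)
  have "(\<lambda>t. \<beta> *\<^sub>R (P_mat M \<phi> *v (\<beta> ^ t *\<^sub>R exp_reward M \<pi> t))) sums (\<beta> *\<^sub>R (P_mat M \<phi> *v v M \<pi> \<beta>))"
    by (intro sums_scaleR_right bounded_linear.sums[OF matrix_vector_mul_bounded_linear] v_sums assms)
  then have "(\<lambda>t. \<beta> ^ Suc t *\<^sub>R exp_reward M (case_nat \<phi> \<pi>) (Suc t)) sums (\<beta> *\<^sub>R (P_mat M \<phi> *v v M \<pi> \<beta>))"
    by (simp add: exp_reward_case_nat matrix_vector_mult_scaleR)
  then have "(\<lambda>t. \<beta> ^ t *\<^sub>R exp_reward M (case_nat \<phi> \<pi>) t) sums (\<beta> *\<^sub>R (P_mat M \<phi> *v v M \<pi> \<beta>) + r_vec M \<phi>)"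
    by (subst (asm) sums_Suc_iff) simp
  from sums_unique2[OF 1 this] show ?thesis
    by (simp add: T_op_def)
qed

lemma v_stat_fixed_point:
  assumes "\<phi> \<in> dec_rules M" "\<bar>\<beta>\<bar> < 1"
  shows "T_op M \<beta> \<phi> (v_stat M \<phi> \<beta>) = v_stat M \<phi> \<beta>"
proof -
  have "case_nat \<phi> (\<lambda>_. \<phi>) = (\<lambda>_. \<phi>)"
    by (rule ext) (simp split: nat.split)
  then show ?thesis
    unfolding v_stat_def using v_case_nat[of "\<lambda>_. \<phi>" \<phi> \<beta>] assms by (simp add: policies_def)
qed

lemma T_op_mono:
  assumes "\<phi> \<in> dec_rules M" "0 \<le> \<beta>" "\<And>y. V $ y \<le> W $ y"
  shows "T_op M \<beta> \<phi> V $ x \<le> T_op M \<beta> \<phi> W $ x"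
  using assms by (simp add: T_op_nth mult_left_mono P_mat_mono)

lemma T_op_le_add:
  assumes "\<phi> \<in> dec_rules M" "0 \<le> \<beta>" "\<And>y. V $ y \<le> W $ y + c"
  shows "T_op M \<beta> \<phi> V $ x \<le> T_op M \<beta> \<phi> W $ x + \<beta> * c"
proof -
  have "(P_mat M \<phi> *v (V - W)) $ x \<le> c"
    by (rule P_mat_le_const[OF assms(1)]) (use assms(3) in \<open>simp add: diff_le_eq add.commute\<close>)
  then have "(T_op M \<beta> \<phi> V - T_op M \<beta> \<phi> W) $ x \<le> \<beta> * c"
    unfolding T_op_diff by (simp add: mult_left_mono assms(2))
  then show ?thesis by simp
qed

text \<open>A minimum principle: at a state where \<open>u\<close> attains its minimum
  \<open>m\<close>, averaging gives at least \<open>m\<close>, so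
  \<open>m \<ge> \<beta> * m\<close>, and \<open>\<beta> < 1\<close> forces
  \<open>m \<ge> 0\<close>.\<close>

lemma discounted_excessive_nonneg:
  assumes "\<phi> \<in> dec_rules M" "0 \<le> \<beta>" "\<beta> < 1" and u: "\<And>x. u $ x \<ge> \<beta> * (P_mat M \<phi> *v u) $ x"
  shows "u $ x \<ge> 0"
proof -
  define m where "m = Min (range (($) u))"
  have m: "m \<le> u $ y" for y
    by (simp add: m_def)
  have "m \<in> range (($) u)"
    unfolding m_def by (rule Min_in) auto
  then obtain y where y: "m = u $ y" by auto
  have "\<beta> * m \<le> \<beta> * (P_mat M \<phi> *v u) $ y"
    using assms m by (intro mult_left_mono P_mat_ge_const) auto
  then have "\<beta> * m \<le> m" using u[of y] y by simp
  then have "(1 - \<beta>) * m \<ge> 0" by (simp add: algebra_simps)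
  then have "m \<ge> 0" using assms by (simp add: zero_le_mult_iff)
  then show ?thesis using m order_trans by blast
qed

text \<open>The value of \<open>\<phi>\<close> is a fixed point of \<open>T_op\<close>, so its
  difference from \<open>W\<close> satisfies the hypothesis of the minimum principle
  \<open>discounted_excessive_nonneg\<close>.\<close>

lemma v_stat_ge:
  assumes "\<phi> \<in> dec_rules M" "0 \<le> \<beta>" "\<beta> < 1" "\<And>x. W $ x \<le> T_op M \<beta> \<phi> W $ x"
  shows "W $ x \<le> v_stat M \<phi> \<beta> $ x"
proof -
  have "\<beta> * (P_mat M \<phi> *v (v_stat M \<phi> \<beta> - W)) $ x \<le> (v_stat M \<phi> \<beta> - W) $ x" for x
  proof -
    have "\<beta> * (P_mat M \<phi> *v (v_stat M \<phi> \<beta> - W)) $ x =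
        (T_op M \<beta> \<phi> (v_stat M \<phi> \<beta>) - T_op M \<beta> \<phi> W) $ x"
      unfolding T_op_diff by simp
    then show ?thesis
      using assms(4)[of x] v_stat_fixed_point[of \<phi> \<beta>] assms by simp
  qed
  from discounted_excessive_nonneg[OF assms(1-3) this, of x] show ?thesis by simp
qed

lemma v_stat_le:
  assumes "\<phi> \<in> dec_rules M" "0 \<le> \<beta>" "\<beta> < 1" "\<And>x. T_op M \<beta> \<phi> W $ x \<le> W $ x"
  shows "v_stat M \<phi> \<beta> $ x \<le> W $ x"
proof -
  have "\<beta> * (P_mat M \<phi> *v (W - v_stat M \<phi> \<beta>)) $ x \<le> (W - v_stat M \<phi> \<beta>) $ x" for x
  proof -
    have "\<beta> * (P_mat M \<phi> *v (W - v_stat M \<phi> \<beta>)) $ x =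
        (T_op M \<beta> \<phi> W - T_op M \<beta> \<phi> (v_stat M \<phi> \<beta>)) $ x"
      unfolding T_op_diff by simp
    then show ?thesis
      using assms(4)[of x] v_stat_fixed_point[of \<phi> \<beta>] assms by simp
  qed
  from discounted_excessive_nonneg[OF assms(1-3) this, of x] show ?thesis by simp
qed

lemma greedy_rule_exists:
  obtains \<psi> where "\<psi> \<in> dec_rules M"
    "\<And>\<xi> x. \<xi> \<in> dec_rules M \<Longrightarrow> T_op M \<beta> \<xi> V $ x \<le> T_op M \<beta> \<psi> V $ x"
proof -
  have "\<exists>\<phi>\<in>dec_rules M. \<forall>\<xi>\<in>dec_rules M. T_op M \<beta> \<xi> V $ x \<le> T_op M \<beta> \<phi> V $ x" for x
  proof -
    let ?A = "(\<lambda>\<xi>. T_op M \<beta> \<xi> V $ x) ` dec_rules M"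
    have "Max ?A \<in> ?A"
      using finite_dec_rules dec_rules_nonempty by (intro Max_in) auto
    then obtain \<phi> where "\<phi> \<in> dec_rules M" "Max ?A = T_op M \<beta> \<phi> V $ x" by auto
    then show ?thesis
      using finite_dec_rules by (metis (no_types, lifting) Max_ge finite_imageI image_eqI)
  qed
  then obtain f where f: "\<And>x. f x \<in> dec_rules M"
    "\<And>x \<xi>. \<xi> \<in> dec_rules M \<Longrightarrow> T_op M \<beta> \<xi> V $ x \<le> T_op M \<beta> (f x) V $ x"
    by metis
  show thesis
  \<comment> \<open>The diagonal rule: at state \<open>x\<close> it takes the action of the rule
    that is best at \<open>x\<close>.\<close>
  proof (rule that[of "\<lambda>x. f x x"])
    show "(\<lambda>x. f x x) \<in> dec_rules M"
      using f(1) by (auto simp: dec_rules_def)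
    show "T_op M \<beta> \<xi> V $ x \<le> T_op M \<beta> (\<lambda>x. f x x) V $ x" if "\<xi> \<in> dec_rules M" for \<xi> x
      using f(2)[OF that, of x] T_op_cong_state[of "\<lambda>x. f x x" x "f x" M \<beta> V] by simp
  qed
qed

text \<open>A stationary policy maximizing the sum of its values over all states cannot be improved by
  its greedy rule, hence solves the optimality equation.\<close>

lemma optimality_equation:
  assumes "0 \<le> \<beta>" "\<beta> < 1"
  shows "\<exists>\<phi>\<in>dec_rules M. V_opt M \<beta> = v_stat M \<phi> \<beta>"
    and "\<xi> \<in> dec_rules M \<Longrightarrow> T_op M \<beta> \<xi> (V_opt M \<beta>) $ x \<le> V_opt M \<beta> $ x"
    and "D_opt M \<beta> = {\<phi> \<in> dec_rules M. T_op M \<beta> \<phi> (V_opt M \<beta>) = V_opt M \<beta>}"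
proof -
  let ?g = "\<lambda>\<phi>. \<Sum>x\<in>UNIV. v_stat M \<phi> \<beta> $ x"
  have \<beta>: "\<bar>\<beta>\<bar> < 1" using assms by simp
  have "Max (?g ` dec_rules M) \<in> ?g ` dec_rules M"
    using finite_dec_rules dec_rules_nonempty by (intro Max_in) auto
  then obtain \<phi> where \<phi>: "\<phi> \<in> dec_rules M" "Max (?g ` dec_rules M) = ?g \<phi>" by blast
  have \<phi>max: "?g \<psi> \<le> ?g \<phi>" if "\<psi> \<in> dec_rules M" for \<psi>
    using \<phi>(2) finite_dec_rules that by (metis (no_types, lifting) Max_ge finite_imageI image_eqI)
  define W where "W = v_stat M \<phi> \<beta>"
  obtain \<psi> where \<psi>: "\<psi> \<in> dec_rules M"
    "\<And>\<xi> x. \<xi> \<in> dec_rules M \<Longrightarrow> T_op M \<beta> \<xi> W $ x \<le> T_op M \<beta> \<psi> W $ x"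
    using greedy_rule_exists by blast
  have 1: "W $ x \<le> T_op M \<beta> \<psi> W $ x" for x
    using \<psi>(2)[OF \<phi>(1), of x] v_stat_fixed_point[OF \<phi>(1) \<beta>] by (simp add: W_def)
  then have 2: "W $ x \<le> v_stat M \<psi> \<beta> $ x" for x
    by (rule v_stat_ge[OF \<psi>(1) assms])
  have 3: "T_op M \<beta> \<psi> W $ x \<le> v_stat M \<psi> \<beta> $ x" for x
    using T_op_mono[OF \<psi>(1) assms(1) 2] v_stat_fixed_point[OF \<psi>(1) \<beta>] by simp
  have "v_stat M \<psi> \<beta> $ x = W $ x" for x
  proof (rule ccontr)
    assume "v_stat M \<psi> \<beta> $ x \<noteq> W $ x"
    then have "W $ x < v_stat M \<psi> \<beta> $ x" using 2[of x] by simp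
    then have "?g \<phi> < ?g \<psi>"
      unfolding W_def[symmetric] by (intro sum_strict_mono_ex1) (auto simp: 2)
    then show False using \<phi>max[OF \<psi>(1)] by simp
  qed
  \<comment> \<open>Any rule yields at most the greedy one, which by \<open>3\<close> yields at most
    the value of \<open>\<psi>\<close>, and this value has just been shown to equal
    \<open>W\<close>.\<close>
  then have TW: "T_op M \<beta> \<xi> W $ x \<le> W $ x" if "\<xi> \<in> dec_rules M" for \<xi> x
    using \<psi>(2)[OF that, of x] 3[of x] by simp
  have "V_opt M \<beta> = W"
  proof (rule vec_eq_iff[THEN iffD2], rule allI)
    fix x
    have "Max ((\<lambda>\<phi>. v_stat M \<phi> \<beta> $ x) ` dec_rules M) = W $ x"
      using finite_dec_rules \<phi>(1) v_stat_le[OF _ assms TW] 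
      by (intro Max_eqI) (auto simp: W_def)
    then show "V_opt M \<beta> $ x = W $ x" by (simp add: V_opt_def)
  qed
  then show V: "\<exists>\<phi>\<in>dec_rules M. V_opt M \<beta> = v_stat M \<phi> \<beta>"
    and "\<xi> \<in> dec_rules M \<Longrightarrow> T_op M \<beta> \<xi> (V_opt M \<beta>) $ x \<le> V_opt M \<beta> $ x"
    using \<phi>(1) TW by (auto simp: W_def)
  \<comment> \<open>A fixed point satisfies both one-step inequalities, so the two comparison lemmas
    together identify it with the value of \<open>\<phi>\<close>.\<close>
  have "V_opt M \<beta> = v_stat M \<phi> \<beta>" if \<phi>: "\<phi> \<in> dec_rules M" "T_op M \<beta> \<phi> (V_opt M \<beta>) = V_opt M \<beta>" for \<phi>
  proof (rule vec_eq_iff[THEN iffD2], intro allI antisym)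
    show "V_opt M \<beta> $ x \<le> v_stat M \<phi> \<beta> $ x" "v_stat M \<phi> \<beta> $ x \<le> V_opt M \<beta> $ x" for x
      using \<phi>(2) by (intro v_stat_ge v_stat_le \<phi>(1) assms; simp)+
  qed
  moreover have "T_op M \<beta> \<phi> (V_opt M \<beta>) = V_opt M \<beta>"
    if \<phi>: "\<phi> \<in> dec_rules M" "V_opt M \<beta> = v_stat M \<phi> \<beta>" for \<phi>
    unfolding \<phi>(2) by (rule v_stat_fixed_point[OF \<phi>(1) \<beta>])
  ultimately show "D_opt M \<beta> = {\<phi> \<in> dec_rules M. T_op M \<beta> \<phi> (V_opt M \<beta>) = V_opt M \<beta>}"
    unfolding D_opt_def by blast
qed

end

section \<open>Value iteration\<close>

text \<open>The sum of finitely many thresholds dominates each of them. This lets bad decision rules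
  be excluded one at a time.\<close>

lemma eventually_finite_uniform_threshold:
  assumes A: "finite A" and P: "\<And>a. a \<in> A \<Longrightarrow> \<exists>N::nat. \<forall>\<^sub>F x in F. \<forall>n\<ge>N. P a x n"
  shows "\<exists>N. \<forall>\<^sub>F x in F. \<forall>n\<ge>N. \<forall>a\<in>A. P a x n"
proof -
  have "\<forall>a\<in>A. \<exists>N. \<forall>\<^sub>F x in F. \<forall>n\<ge>N. P a x n"
    using P by (rule ballI)
  from bchoice[OF this] obtain N where N: "\<forall>a\<in>A. \<forall>\<^sub>F x in F. \<forall>n\<ge>N a. P a x n" ..
  have "N a \<le> (\<Sum>a\<in>A. N a)" if "a \<in> A" for a
    using A that by (intro member_le_sum) auto
  then have "\<forall>\<^sub>F x in F. \<forall>n\<ge>\<Sum>a\<in>A. N a. \<forall>a\<in>A. P a x n"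
    by (intro eventually_mono[OF eventually_ball_finite[OF A N]]) (meson order_trans)
  then show ?thesis ..
qed

text \<open>At time \<open>i\<close> there remain \<open>n - i\<close> stages, so the rule used then
  must be greedy for that stage; induction strips off the first rule. A sequence that is greedy at
  two discount factors yields the same coefficients at both.\<close>

lemma V_fin_horizon:
  assumes "\<And>i. i < n \<Longrightarrow> \<sigma> i \<in> D_fin M \<beta> (n - i)"
  shows "V_fin M \<beta> n = (\<Sum>t\<le>n. \<beta> ^ t *\<^sub>R horizon_coeff M \<sigma> n t)"
  using assms
proof (induction n arbitrary: \<sigma>)
  case 0
  then show ?case by (simp add: horizon_coeff_def)
next
  case (Suc n)
  have "V_fin M \<beta> n = (\<Sum>t\<le>n. \<beta> ^ t *\<^sub>R horizon_coeff M (\<lambda>i. \<sigma> (Suc i)) n t)"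
    using Suc.prems by (intro Suc.IH) force
  moreover have "V_fin M \<beta> (Suc n) = T_op M \<beta> (\<sigma> 0) (V_fin M \<beta> n)"
    using Suc.prems[of 0] by (simp add: D_fin_def)
  moreover have "case_nat (\<sigma> 0) (\<lambda>i. \<sigma> (Suc i)) = \<sigma>"
    by (rule ext) (simp split: nat.split)
  ultimately show ?case
    using T_op_horizon[of M \<beta> "\<sigma> 0" "\<lambda>i. \<sigma> (Suc i)" n] by (simp only:)
qed

lemma tendsto_T_op:
  assumes "(V \<longlongrightarrow> W) (at \<alpha>)"
  shows "((\<lambda>\<beta>. T_op M \<beta> \<phi> (V \<beta>)) \<longlongrightarrow> T_op M \<alpha> \<phi> W) (at \<alpha>)"
  unfolding T_op_def
  by (intro tendsto_intros bounded_linear.tendsto[OF matrix_vector_mul_bounded_linear] assms)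

context
  fixes M :: "('x::finite, 'a) mdp"
  assumes fin: "finite_mdp M"
begin

lemma V_fin_Suc_ge:
  assumes "\<phi> \<in> dec_rules M"
  shows "T_op M \<beta> \<phi> (V_fin M \<beta> n) $ x \<le> V_fin M \<beta> (Suc n) $ x"
  using assms finite_dec_rules[OF fin] by simp

lemma D_fin_nonempty: "D_fin M \<beta> (Suc n) \<noteq> {}"
proof -
  obtain \<psi> where \<psi>: "\<psi> \<in> dec_rules M"
    "\<And>\<phi> x. \<phi> \<in> dec_rules M \<Longrightarrow> T_op M \<beta> \<phi> (V_fin M \<beta> n) $ x \<le> T_op M \<beta> \<psi> (V_fin M \<beta> n) $ x"
    using greedy_rule_exists[OF fin] by blast
  then have "V_fin M \<beta> (Suc n) = T_op M \<beta> \<psi> (V_fin M \<beta> n)"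
    using finite_dec_rules[OF fin] by (auto simp: vec_eq_iff intro!: Max_eqI)
  with \<psi>(1) show ?thesis by (auto simp: D_fin_def)
qed

text \<open>\<open>V_fin\<close> dominates every one-step value, so failure of equality is a strict
  loss at some state. Rules are excluded below by exhibiting such a state.\<close>

lemma not_in_D_fin:
  assumes "\<phi> \<in> dec_rules M"
  shows "\<phi> \<notin> D_fin M \<beta> (Suc n) \<longleftrightarrow>
    (\<exists>x. T_op M \<beta> \<phi> (V_fin M \<beta> n) $ x < V_fin M \<beta> (Suc n) $ x)"
proof -
  have "V_fin M \<beta> (Suc n) = T_op M \<beta> \<phi> (V_fin M \<beta> n) \<longleftrightarrow>
      (\<forall>x. V_fin M \<beta> (Suc n) $ x \<le> T_op M \<beta> \<phi> (V_fin M \<beta> n) $ x)"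
    by (auto simp: vec_eq_iff order.eq_iff V_fin_Suc_ge[OF assms] simp del: V_fin.simps)
  then show ?thesis
    using assms by (auto simp: D_fin_def not_le simp del: V_fin.simps)
qed

text \<open>Each stage contracts the error by \<open>\<beta>\<close>: an optimal rule bounds the new
  iterate from below, a greedy rule bounds it from above.\<close>

lemma value_iteration_error:
  assumes "0 \<le> \<beta>" "\<beta> < 1" "\<And>x. \<bar>s_vec M $ x - V_opt M \<beta> $ x\<bar> \<le> C"
  shows "\<bar>V_fin M \<beta> n $ x - V_opt M \<beta> $ x\<bar> \<le> \<beta> ^ n * C"
proof (induction n arbitrary: x)
  case 0
  then show ?case using assms(3) by simp
next
  case (Suc n)
  have le: "V_fin M \<beta> n $ y \<le> V_opt M \<beta> $ y + \<beta> ^ n * C"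
    and ge: "V_opt M \<beta> $ y \<le> V_fin M \<beta> n $ y + \<beta> ^ n * C" for y
    using Suc.IH[of y] by (auto simp: abs_le_iff)
  obtain \<psi> where \<psi>: "\<psi> \<in> dec_rules M" "V_fin M \<beta> (Suc n) = T_op M \<beta> \<psi> (V_fin M \<beta> n)"
    using D_fin_nonempty[of \<beta> n] by (auto simp: D_fin_def)
  obtain \<phi> where \<phi>: "\<phi> \<in> dec_rules M" "V_opt M \<beta> = v_stat M \<phi> \<beta>"
    using optimality_equation(1)[OF fin assms(1,2)] by blast
  have "V_opt M \<beta> $ x = T_op M \<beta> \<phi> (V_opt M \<beta>) $ x"
    using v_stat_fixed_point[OF fin \<phi>(1)] \<phi>(2) assms by simp
  also have "\<dots> \<le> T_op M \<beta> \<phi> (V_fin M \<beta> n) $ x + \<beta> * (\<beta> ^ n * C)"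
    by (rule T_op_le_add[OF fin \<phi>(1) assms(1) ge])
  also have "\<dots> \<le> V_fin M \<beta> (Suc n) $ x + \<beta> * (\<beta> ^ n * C)"
    using V_fin_Suc_ge[OF \<phi>(1)] by (intro add_right_mono)
  finally have 1: "V_opt M \<beta> $ x \<le> V_fin M \<beta> (Suc n) $ x + \<beta> * (\<beta> ^ n * C)" .
  have "V_fin M \<beta> (Suc n) $ x \<le> T_op M \<beta> \<psi> (V_opt M \<beta>) $ x + \<beta> * (\<beta> ^ n * C)"
    unfolding \<psi>(2) by (rule T_op_le_add[OF fin \<psi>(1) assms(1) le])
  also have "\<dots> \<le> V_opt M \<beta> $ x + \<beta> * (\<beta> ^ n * C)"
    by (intro add_right_mono optimality_equation(2)[OF fin assms(1,2) \<psi>(1)])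
  finally show ?case
    using 1 by (simp add: abs_le_iff mult.assoc del: V_fin.simps)
qed

section \<open>Dependence of values and greedy rules on the discount factor\<close>

lemma v_has_derivative:
  assumes \<pi>: "\<pi> \<in> policies (dec_rules M)" and \<alpha>: "\<bar>\<alpha>\<bar> < 1"
  shows "((\<lambda>\<beta>. v M \<pi> \<beta> $ x) has_real_derivative
    (\<Sum>t. diffs (\<lambda>t. exp_reward M \<pi> t $ x) t * \<alpha> ^ t)) (at \<alpha>)"
proof -
  obtain R where R: "\<And>t x. \<bar>exp_reward M \<pi> t $ x\<bar> \<le> R"
    using coefficients_bounded[OF fin] \<pi> by blast
  show ?thesis
    \<comment> \<open>The power series formula for \<open>v\<close> is available for discount
      factors of modulus below 1, so the derivative is transferred on that open interval.\<close>
    by (rule has_field_derivative_transform_within_open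
        [OF DERIV_bounded_power_series[OF R \<alpha>], of "{-1<..<1}"])
      (use \<alpha> v_nth[OF fin \<pi>] in auto)
qed

lemma tendsto_v_stat:
  assumes "\<phi> \<in> dec_rules M" "\<bar>\<alpha>\<bar> < 1"
  shows "((\<lambda>\<beta>. v_stat M \<phi> \<beta> $ x) \<longlongrightarrow> v_stat M \<phi> \<alpha> $ x) (at \<alpha>)"
  using DERIV_isCont[OF v_has_derivative[OF stationary_policies[OF assms(1)] assms(2)]]
  unfolding isCont_def v_stat_def .

lemma tendsto_V_opt:
  assumes "\<bar>\<alpha>\<bar> < 1"
  shows "(V_opt M \<longlongrightarrow> V_opt M \<alpha>) (at \<alpha>)"
proof (rule vec_tendstoI)
  show "((\<lambda>\<beta>. V_opt M \<beta> $ x) \<longlongrightarrow> V_opt M \<alpha> $ x) (at \<alpha>)" for x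
    unfolding V_opt_def vec_lambda_beta
    by (intro tendsto_Max_image finite_dec_rules dec_rules_nonempty fin tendsto_v_stat assms)
qed

lemma tendsto_V_fin: "((\<lambda>\<beta>. V_fin M \<beta> n) \<longlongrightarrow> V_fin M \<alpha> n) (at \<alpha>)"
proof (induction n)
  case (Suc n)
  show ?case
  proof (rule vec_tendstoI)
    show "((\<lambda>\<beta>. V_fin M \<beta> (Suc n) $ x) \<longlongrightarrow> V_fin M \<alpha> (Suc n) $ x) (at \<alpha>)" for x
      unfolding V_fin.simps vec_lambda_beta
      by (intro tendsto_Max_image finite_dec_rules dec_rules_nonempty fin tendsto_vec_nth
          tendsto_T_op Suc.IH)
  qed
qed simp

text \<open>A strict loss at \<open>\<alpha>\<close> persists nearby by continuity, and there are
  finitely many rules. The neighbourhood may depend on \<open>n\<close>.\<close>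

lemma D_fin_eventually_subset: "\<forall>\<^sub>F \<beta> in at \<alpha>. D_fin M \<beta> (Suc n) \<subseteq> D_fin M \<alpha> (Suc n)"
proof -
  have "\<forall>\<^sub>F \<beta> in at \<alpha>. \<phi> \<notin> D_fin M \<beta> (Suc n)"
    if "\<phi> \<in> dec_rules M - D_fin M \<alpha> (Suc n)" for \<phi>
  proof -
    from that obtain x where "T_op M \<alpha> \<phi> (V_fin M \<alpha> n) $ x < V_fin M \<alpha> (Suc n) $ x"
      using not_in_D_fin[of \<phi>] by blast
    then have "0 < (V_fin M \<alpha> (Suc n) - T_op M \<alpha> \<phi> (V_fin M \<alpha> n)) $ x"
      by simp
    moreover have "((\<lambda>\<beta>. (V_fin M \<beta> (Suc n) - T_op M \<beta> \<phi> (V_fin M \<beta> n)) $ x) \<longlongrightarrow>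
        (V_fin M \<alpha> (Suc n) - T_op M \<alpha> \<phi> (V_fin M \<alpha> n)) $ x) (at \<alpha>)"
      by (intro tendsto_vec_nth tendsto_diff tendsto_T_op tendsto_V_fin)
    ultimately have "\<forall>\<^sub>F \<beta> in at \<alpha>. 0 < (V_fin M \<beta> (Suc n) - T_op M \<beta> \<phi> (V_fin M \<beta> n)) $ x"
      by (rule order_tendstoD(1)[rotated])
    then show ?thesis
      by (rule eventually_mono) (auto simp: D_fin_def simp del: V_fin.simps)
  qed
  then have "\<forall>\<^sub>F \<beta> in at \<alpha>. \<forall>\<phi>\<in>dec_rules M - D_fin M \<alpha> (Suc n). \<phi> \<notin> D_fin M \<beta> (Suc n)"
    using finite_dec_rules[OF fin] by (intro eventually_ball_finite) auto
  then show ?thesis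
    by (rule eventually_mono) (auto simp: D_fin_def simp del: V_fin.simps)
qed

text \<open>A rule not optimal at \<open>\<alpha>\<close> violates the optimality equation by some
  \<open>\<gamma> > 0\<close> at some state. Near \<open>\<alpha>\<close> a violation above
  \<open>\<gamma> / 2\<close> remains, while the error of value iteration becomes at most
  \<open>\<gamma> / 4\<close> after a number of stages independent of
  \<open>\<beta>\<close>.\<close>

lemma D_fin_eventually_optimal:
  assumes \<alpha>: "0 < \<alpha>" "\<alpha> < 1"
  shows "\<exists>N. \<forall>\<^sub>F \<beta> in at \<alpha>. \<forall>n\<ge>N. D_fin M \<beta> (Suc n) \<subseteq> D_opt M \<alpha>"
proof -
  have "\<exists>N. \<forall>\<^sub>F \<beta> in at \<alpha>. \<forall>n\<ge>N. \<phi> \<notin> D_fin M \<beta> (Suc n)"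
    if \<phi>: "\<phi> \<in> dec_rules M - D_opt M \<alpha>" for \<phi>
  proof -
    let ?gap = "\<lambda>\<beta> x. (V_opt M \<beta> - T_op M \<beta> \<phi> (V_opt M \<beta>)) $ x"
    have \<alpha>1: "\<bar>\<alpha>\<bar> < 1" using \<alpha> by simp
    have "\<exists>x. ?gap \<alpha> x > 0"
    proof (rule ccontr)
      assume "\<not> (\<exists>x. ?gap \<alpha> x > 0)"
      then have "T_op M \<alpha> \<phi> (V_opt M \<alpha>) $ x = V_opt M \<alpha> $ x" for x
        using optimality_equation(2)[OF fin, of \<alpha> \<phi> x] \<alpha> \<phi>
        by (intro order.antisym) (auto simp: not_less)
      then show False
        using \<phi> optimality_equation(3)[OF fin, of \<alpha>] \<alpha> by (auto simp: vec_eq_iff)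
    qed
    then obtain x where x: "?gap \<alpha> x > 0" by blast
    define \<gamma> where "\<gamma> = ?gap \<alpha> x"
    have gap_ev: "\<forall>\<^sub>F \<beta> in at \<alpha>. ?gap \<beta> x > \<gamma> / 2"
      by (rule order_tendstoD(1)[where y = \<gamma>], unfold \<gamma>_def)
         (intro tendsto_vec_nth tendsto_diff tendsto_T_op tendsto_V_opt \<alpha>1, use x in simp)
    \<comment> \<open>The extra 1 makes the bound strict at \<open>\<alpha>\<close>, so it survives
      for nearby \<open>\<beta>\<close>.\<close>
    define C where "C = 1 + (\<Sum>x\<in>UNIV. \<bar>s_vec M $ x - V_opt M \<alpha> $ x\<bar>)"
    have "\<bar>s_vec M $ y - V_opt M \<alpha> $ y\<bar> < C" for y
      using member_le_sum[of y UNIV "\<lambda>y. \<bar>s_vec M $ y - V_opt M \<alpha> $ y\<bar>"] by (simp add: C_def)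
    then have "\<forall>\<^sub>F \<beta> in at \<alpha>. \<bar>s_vec M $ y - V_opt M \<beta> $ y\<bar> < C" for y
      by (intro order_tendstoD(2)[where y = "\<bar>s_vec M $ y - V_opt M \<alpha> $ y\<bar>"]
          tendsto_rabs tendsto_diff tendsto_const tendsto_vec_nth tendsto_V_opt \<alpha>1)
    then have C_ev: "\<forall>\<^sub>F \<beta> in at \<alpha>. \<forall>y. \<bar>s_vec M $ y - V_opt M \<beta> $ y\<bar> < C"
      by (rule eventually_all_finite)
    have C: "C > 0"
      unfolding C_def by (intro add_pos_nonneg sum_nonneg) auto
    \<comment> \<open>The midpoint between \<open>\<alpha>\<close> and 1 gives one geometric rate
      for all nearby \<open>\<beta>\<close>.\<close>
    define \<rho> where "\<rho> = (1 + \<alpha>) / 2"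
    have \<rho>: "0 < \<rho>" "\<rho> < 1" "\<alpha> < \<rho>" using \<alpha> by (auto simp: \<rho>_def)
    obtain N where N: "\<rho> ^ N < \<gamma> / (4 * C)"
      using real_arch_pow_inv[OF _ \<rho>(2), of "\<gamma> / (4 * C)"] C x by (auto simp: \<gamma>_def)
    have "\<forall>\<^sub>F \<beta> in at \<alpha>. 0 < \<beta>" "\<forall>\<^sub>F \<beta> in at \<alpha>. \<beta> < \<rho>"
      by (rule order_tendstoD[OF tendsto_ident_at], use \<alpha> \<rho> in simp)+
    then have "\<forall>\<^sub>F \<beta> in at \<alpha>. \<forall>n\<ge>N. \<phi> \<notin> D_fin M \<beta> (Suc n)"
      using gap_ev C_ev
    proof eventually_elim
      case (elim \<beta>)
      have \<beta>: "0 \<le> \<beta>" "\<beta> < 1" using elim \<rho> by auto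
      show ?case
      proof (intro allI impI)
        fix n assume n: "n \<ge> N"
        have err: "\<bar>V_fin M \<beta> m $ y - V_opt M \<beta> $ y\<bar> \<le> \<gamma> / 4" if "m \<ge> N" for m y
        proof -
          have "\<beta> ^ m \<le> \<rho> ^ m" using elim \<beta> by (intro power_mono) auto
          also have "\<dots> \<le> \<rho> ^ N" using that \<rho> by (intro power_decreasing) auto
          finally have "\<beta> ^ m * C \<le> \<gamma> / (4 * C) * C"
            using N C by (intro mult_right_mono) auto
          moreover have "\<bar>V_fin M \<beta> m $ y - V_opt M \<beta> $ y\<bar> \<le> \<beta> ^ m * C"
            using elim by (intro value_iteration_error \<beta>) (auto intro: less_imp_le)
          ultimately show ?thesis using C by simp
        qed
        have "V_fin M \<beta> n $ y \<le> V_opt M \<beta> $ y + \<gamma> / 4" for y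
          using abs_le_D1[OF err[OF n, of y]] by simp
        then have "T_op M \<beta> \<phi> (V_fin M \<beta> n) $ x \<le> T_op M \<beta> \<phi> (V_opt M \<beta>) $ x + \<beta> * (\<gamma> / 4)"
          using \<phi> by (intro T_op_le_add fin \<beta>) auto
        moreover have "\<beta> * (\<gamma> / 4) \<le> \<gamma> / 4"
          using \<beta> x by (intro mult_left_le_one_le) (auto simp: \<gamma>_def)
        moreover have "V_opt M \<beta> $ x \<le> V_fin M \<beta> (Suc n) $ x + \<gamma> / 4"
          using abs_le_D2[OF err[of "Suc n" x]] n by (simp del: V_fin.simps)
        \<comment> \<open>The two errors of \<open>\<gamma> / 4\<close> use up a margin of
          \<open>\<gamma> / 2\<close>; strictness comes from the violation at \<open>\<beta>\<close>
          exceeding that margin.\<close>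
        ultimately have "T_op M \<beta> \<phi> (V_fin M \<beta> n) $ x < V_fin M \<beta> (Suc n) $ x"
          using elim by (simp del: V_fin.simps)
        then show "\<phi> \<notin> D_fin M \<beta> (Suc n)"
          using not_in_D_fin[of \<phi>] \<phi> by blast
      qed
    qed
    then show ?thesis ..
  qed
  then obtain N where
    "\<forall>\<^sub>F \<beta> in at \<alpha>. \<forall>n\<ge>N. \<forall>\<phi>\<in>dec_rules M - D_opt M \<alpha>. \<phi> \<notin> D_fin M \<beta> (Suc n)"
    using eventually_finite_uniform_threshold[of "dec_rules M - D_opt M \<alpha>"
        "\<lambda>\<phi> \<beta> n. \<phi> \<notin> D_fin M \<beta> (Suc n)" "at \<alpha>"] finite_dec_rules[OF fin] by blast
  then have "\<forall>\<^sub>F \<beta> in at \<alpha>. \<forall>n\<ge>N. D_fin M \<beta> (Suc n) \<subseteq> D_opt M \<alpha>"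
    by (rule eventually_mono) (auto simp: D_fin_def simp del: V_fin.simps)
  then show ?thesis ..
qed

text \<open>Both \<open>V_opt\<close> and the value of \<open>\<phi>\<close> are continuous in the
  discount factor, so a nonzero difference at \<open>\<alpha>\<close> would persist nearby.\<close>

lemma frequently_optimal_imp_optimal:
  assumes \<alpha>: "0 < \<alpha>" "\<alpha> < 1" and fr: "\<exists>\<^sub>F \<beta> in at \<alpha>. \<phi> \<in> D_opt M \<beta>"
  shows "\<phi> \<in> D_opt M \<alpha>"
proof (rule ccontr)
  assume notin: "\<phi> \<notin> D_opt M \<alpha>"
  have \<phi>: "\<phi> \<in> dec_rules M"
    using frequently_ex[OF fr] by (auto simp: D_opt_def)
  with notin obtain x where "(V_opt M \<alpha> - v_stat M \<phi> \<alpha>) $ x \<noteq> 0"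
    by (auto simp: D_opt_def vec_eq_iff)
  moreover have "((\<lambda>\<beta>. (V_opt M \<beta> - v_stat M \<phi> \<beta>) $ x) \<longlongrightarrow> (V_opt M \<alpha> - v_stat M \<phi> \<alpha>) $ x) (at \<alpha>)"
    unfolding vector_minus_component
    using \<alpha> \<phi> by (intro tendsto_diff tendsto_vec_nth[OF tendsto_V_opt] tendsto_v_stat) auto
  ultimately have "\<forall>\<^sub>F \<beta> in at \<alpha>. (V_opt M \<beta> - v_stat M \<phi> \<beta>) $ x \<noteq> 0"
    by (rule tendsto_imp_eventually_ne[rotated])
  from frequently_ex[OF frequently_eventually_conj[OF fr this]] show False
    by (auto simp: D_opt_def)
qed

text \<open>For each competitor \<open>\<psi>\<close> and each state, the difference of values is a
  power series with bounded coefficients, nonnegative frequently and hence eventually; finitely many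
  such conditions can be imposed together.\<close>

lemma frequently_optimal_imp_eventually_optimal:
  assumes \<alpha>: "0 < \<alpha>" "\<alpha> < 1" and S: "convex S" "\<alpha> \<notin> S"
    and fr: "\<exists>\<^sub>F \<beta> in at \<alpha> within S. \<phi> \<in> D_opt M \<beta>"
  shows "\<forall>\<^sub>F \<beta> in at \<alpha> within S. \<phi> \<in> D_opt M \<beta>"
proof -
  have \<phi>: "\<phi> \<in> dec_rules M"
    using frequently_ex[OF fr] by (auto simp: D_opt_def)
  have "\<forall>\<^sub>F \<beta> in at \<alpha>. \<bar>\<beta>\<bar> < 1"
    by (rule order_tendstoD(2)[OF tendsto_rabs[OF tendsto_ident_at]]) (use \<alpha> in simp)
  then have lt1: "\<forall>\<^sub>F \<beta> in at \<alpha> within S. \<bar>\<beta>\<bar> < 1"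
    by (rule filter_leD[OF at_le[OF subset_UNIV]])
  have le: "v_stat M \<psi> \<beta> $ x \<le> v_stat M \<phi> \<beta> $ x" if "\<phi> \<in> D_opt M \<beta>" "\<psi> \<in> dec_rules M" for \<psi> \<beta> x
  proof -
    have "v_stat M \<psi> \<beta> $ x \<le> V_opt M \<beta> $ x"
      using finite_dec_rules[OF fin] that(2) by (simp add: V_opt_def)
    with that(1) show ?thesis by (simp add: D_opt_def)
  qed
  have "\<forall>\<^sub>F \<beta> in at \<alpha> within S. v_stat M \<psi> \<beta> $ x \<le> v_stat M \<phi> \<beta> $ x" if \<psi>: "\<psi> \<in> dec_rules M" for \<psi> x
  proof -
    define a where "a = (\<lambda>t. exp_reward M (\<lambda>_. \<phi>) t $ x - exp_reward M (\<lambda>_. \<psi>) t $ x)"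
    obtain R where R: "\<And>\<pi> t x. \<pi> \<in> policies (dec_rules M) \<Longrightarrow> \<bar>exp_reward M \<pi> t $ x\<bar> \<le> R"
      using coefficients_bounded[OF fin] by blast
    note R\<phi> = R[OF stationary_policies[OF \<phi>]] and R\<psi> = R[OF stationary_policies[OF \<psi>]]
    have a: "\<bar>a t\<bar> \<le> 2 * R" for t
      unfolding a_def using R\<phi>[of t x] R\<psi>[of t x] by linarith
    have eq: "v_stat M \<phi> \<beta> $ x - v_stat M \<psi> \<beta> $ x = (\<Sum>t. a t * \<beta> ^ t)" if "\<bar>\<beta>\<bar> < 1" for \<beta>
    proof -
      have "(\<Sum>t. a t * \<beta> ^ t) = (\<Sum>t. exp_reward M (\<lambda>_. \<phi>) t $ x * \<beta> ^ t - exp_reward M (\<lambda>_. \<psi>) t $ x * \<beta> ^ t)"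
        by (simp add: a_def left_diff_distrib)
      also have "\<dots> = v_stat M \<phi> \<beta> $ x - v_stat M \<psi> \<beta> $ x"
        unfolding v_stat_def v_nth[OF fin stationary_policies[OF \<phi>] that]
          v_nth[OF fin stationary_policies[OF \<psi>] that]
        by (rule suminf_diff[symmetric]; rule summable_bounded_power_series[where R = R])
           (use R\<phi> R\<psi> that in auto)
      finally show ?thesis ..
    qed
    have "\<exists>\<^sub>F \<beta> in at \<alpha> within S. 0 \<le> (\<Sum>t. a t * \<beta> ^ t)"
    proof (rule frequently_elim1[OF frequently_eventually_conj[OF fr lt1]])
      fix \<beta> assume "\<bar>\<beta>\<bar> < 1 \<and> \<phi> \<in> D_opt M \<beta>"
      then show "0 \<le> (\<Sum>t. a t * \<beta> ^ t)"
        using le[OF _ \<psi>, of \<beta> x] eq[of \<beta>] by simp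
    qed
    then have "\<forall>\<^sub>F \<beta> in at \<alpha> within S. 0 \<le> (\<Sum>t. a t * \<beta> ^ t)"
      using \<alpha> by (intro bounded_power_series_sign_eventually_constant[OF a _ S]) auto
    with lt1 show ?thesis
    proof eventually_elim
      case (elim \<beta>)
      then show ?case using eq[of \<beta>] by simp
    qed
  qed
  then have "\<forall>\<^sub>F \<beta> in at \<alpha> within S. \<forall>\<psi>\<in>dec_rules M. \<forall>x. v_stat M \<psi> \<beta> $ x \<le> v_stat M \<phi> \<beta> $ x"
    using finite_dec_rules[OF fin]
    by (intro eventually_ball_finite ballI eventually_all_finite) auto
  then show ?thesis
  proof eventually_elim
    case (elim \<beta>)
    then have "Max ((\<lambda>\<psi>. v_stat M \<psi> \<beta> $ x) ` dec_rules M) = v_stat M \<phi> \<beta> $ x" for x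
      using finite_dec_rules[OF fin] \<phi> by (intro Max_eqI) auto
    then show ?case
      using \<phi> by (simp add: D_opt_def V_opt_def vec_eq_iff)
  qed
qed

end

section \<open>One-sided neighbourhoods of a discount factor\<close>

lemma has_vector_derivative_vecI:
  fixes f :: "real \<Rightarrow> real ^ 'n"
  assumes "\<And>x. ((\<lambda>t. f t $ x) has_real_derivative d $ x) (at a)"
  shows "(f has_vector_derivative d) (at a)"
  unfolding has_vector_derivative_def
proof (subst has_derivative_componentwise_within, rule ballI)
  fix i :: "real ^ 'n" assume "i \<in> Basis"
  then obtain x where "i = axis x 1"
    by (auto simp: Basis_vec_def)
  with assms[of x] show "((\<lambda>t. f t \<bullet> i) has_derivative (\<lambda>t. (t *\<^sub>R d) \<bullet> i)) (at a)"
    by (simp add: inner_axis has_field_derivative_def mult.commute[of _ "d $ x"])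
qed

text \<open>Optimality somewhere in every punctured one-sided neighbourhood is the filter notion
  "frequently". With \<open>S\<close> a half-line this describes \<open>D_minus\<close> or
  \<open>D_plus\<close>.\<close>

lemma Inter_D_set_eq_frequently:
  assumes \<alpha>: "0 < \<alpha>" "\<alpha> < 1" and S: "\<alpha> \<notin> S"
  shows "(\<Inter>i\<in>{1::nat..}. D_set M ({\<beta> \<in> S. dist \<beta> \<alpha> < 1 / real i} \<inter> {0..<1})) =
    {\<phi>. \<exists>\<^sub>F \<beta> in at \<alpha> within S. \<phi> \<in> D_opt M \<beta>}"
proof (intro set_eqI iffI)
  fix \<phi>
  assume *: "\<phi> \<in> (\<Inter>i\<in>{1::nat..}. D_set M ({\<beta> \<in> S. dist \<beta> \<alpha> < 1 / real i} \<inter> {0..<1}))"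
  have "\<not> (\<forall>\<^sub>F \<beta> in at \<alpha> within S. \<phi> \<notin> D_opt M \<beta>)"
  proof
    assume "\<forall>\<^sub>F \<beta> in at \<alpha> within S. \<phi> \<notin> D_opt M \<beta>"
    then obtain d where d: "d > 0" "\<And>\<beta>. \<beta> \<in> S \<Longrightarrow> dist \<beta> \<alpha> < d \<Longrightarrow> \<phi> \<notin> D_opt M \<beta>"
      using S unfolding eventually_at by metis
    obtain i where i: "inverse (real (Suc i)) < d"
      using reals_Archimedean[OF d(1)] by blast
    have "\<phi> \<in> D_set M ({\<beta> \<in> S. dist \<beta> \<alpha> < 1 / real (Suc i)} \<inter> {0..<1})"
      using * by (rule INT_D) simp
    then obtain \<beta> where "\<beta> \<in> S" "dist \<beta> \<alpha> < 1 / real (Suc i)" "\<phi> \<in> D_opt M \<beta>"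
      by (auto simp: D_set_def)
    with i d(2)[of \<beta>] show False by (simp add: inverse_eq_divide)
  qed
  then show "\<phi> \<in> {\<phi>. \<exists>\<^sub>F \<beta> in at \<alpha> within S. \<phi> \<in> D_opt M \<beta>}"
    by (simp add: frequently_def)
next
  fix \<phi>
  assume "\<phi> \<in> {\<phi>. \<exists>\<^sub>F \<beta> in at \<alpha> within S. \<phi> \<in> D_opt M \<beta>}"
  then have fr: "\<exists>\<^sub>F \<beta> in at \<alpha> within S. \<phi> \<in> D_opt M \<beta>" by simp
  show "\<phi> \<in> (\<Inter>i\<in>{1::nat..}. D_set M ({\<beta> \<in> S. dist \<beta> \<alpha> < 1 / real i} \<inter> {0..<1}))"
  proof (rule INT_I)
    fix i :: nat assume "i \<in> {1..}"
    \<comment> \<open>The bound \<open>min \<alpha> (1 - \<alpha>)\<close> keeps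
      \<open>\<beta>\<close> in the admissible range \<open>{0..<1}\<close>.\<close>
    then have "\<forall>\<^sub>F \<beta> in at \<alpha> within S. \<beta> \<in> S \<and> dist \<beta> \<alpha> < min (1 / real i) (min \<alpha> (1 - \<alpha>))"
      using \<alpha> unfolding eventually_at
      by (intro exI[of _ "min (1 / real i) (min \<alpha> (1 - \<alpha>))"]) auto
    from frequently_ex[OF frequently_eventually_conj[OF fr this]]
    obtain \<beta> where "\<beta> \<in> S" "dist \<beta> \<alpha> < 1 / real i" "dist \<beta> \<alpha> < min \<alpha> (1 - \<alpha>)" "\<phi> \<in> D_opt M \<beta>"
      by auto
    then show "\<phi> \<in> D_set M ({\<beta> \<in> S. dist \<beta> \<alpha> < 1 / real i} \<inter> {0..<1})"
      by (auto simp: D_set_def dist_real_def intro!: bexI[of _ \<beta>])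
  qed
qed

lemma turnpike_le:
  assumes "\<forall>n\<ge>N. D_fin M \<beta> (Suc n) \<subseteq> D_opt M \<beta>"
  shows "turnpike M \<beta> \<le> Suc N"
  unfolding turnpike_def
proof (rule Least_le, intro conjI allI impI)
  fix n assume "Suc N \<le> n"
  then show "D_fin M \<beta> n \<subseteq> D_opt M \<beta>"
    using assms by (cases n) auto
qed simp

text \<open>Converts an eventual bound into an explicit radius, shrunk to stay within the admissible
  discount factors; \<open>E\<close> is left free so that either one-sided interval can be
  inserted.\<close>

lemma turnpike_sup_finite:
  assumes \<alpha>: "0 < \<alpha>" "\<alpha> < 1" and "\<forall>\<^sub>F \<beta> in at \<alpha> within S. turnpike M \<beta> \<le> N" and "\<alpha> \<notin> S"
  obtains \<delta> where "\<delta> > 0" "{\<alpha> - \<delta><..<\<alpha> + \<delta>} \<subseteq> {0..<1}"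
    "\<And>E. E \<subseteq> S \<inter> {\<alpha> - \<delta><..<\<alpha> + \<delta>} \<Longrightarrow> turnpike_sup M E < \<infinity>"
proof -
  obtain d where d: "d > 0" "\<And>\<beta>. \<beta> \<in> S \<Longrightarrow> dist \<beta> \<alpha> < d \<Longrightarrow> turnpike M \<beta> \<le> N"
    using assms(3,4) unfolding eventually_at by metis
  show thesis
  proof (rule that[of "min d (min \<alpha> (1 - \<alpha>))"])
    show "turnpike_sup M E < \<infinity>"
      if "E \<subseteq> S \<inter> {\<alpha> - min d (min \<alpha> (1 - \<alpha>))<..<\<alpha> + min d (min \<alpha> (1 - \<alpha>))}" for E
    proof -
      have "turnpike M \<beta> \<le> N" if "\<beta> \<in> E" for \<beta>
      proof (rule d(2))
        have "\<beta> \<in> S \<inter> {\<alpha> - min d (min \<alpha> (1 - \<alpha>))<..<\<alpha> + min d (min \<alpha> (1 - \<alpha>))}"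
          using \<open>E \<subseteq> _\<close> that by blast
        then show "\<beta> \<in> S" "dist \<beta> \<alpha> < d"
          by (auto simp: dist_real_def abs_less_iff)
      qed
      then have "turnpike_sup M E \<le> enat N"
        unfolding turnpike_sup_def by (intro SUP_least) simp
      then show ?thesis
        using enat_ord_simps(4) le_less_trans by blast
    qed
  qed (use \<alpha> d in auto)
qed

section \<open>Excluding rules that are not optimal on the given side\<close>

context
  fixes M :: "('x::finite, 'a) mdp"
  assumes fin: "finite_mdp M"
begin

text \<open>Termwise differentiation turns the derivative in Condition B into a series that can be
  compared with truncated horizons by \<open>diffs_power_series_tail\<close>.\<close>

lemma dv_diff_nth:
  assumes \<pi>: "\<pi> \<in> policies (dec_rules M)" and \<phi>: "\<phi> \<in> dec_rules M" and \<psi>: "\<psi> \<in> dec_rules M"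
    and \<alpha>: "\<bar>\<alpha>\<bar> < 1"
  shows "dv_diff M \<alpha> \<phi> \<psi> \<pi> $ x =
    (\<Sum>t. diffs (\<lambda>t. exp_reward M (case_nat \<phi> \<pi>) t $ x - exp_reward M (case_nat \<psi> \<pi>) t $ x) t * \<alpha> ^ t)"
proof -
  let ?e = "\<lambda>\<xi> x t. exp_reward M (case_nat \<xi> \<pi>) t $ x"
  have pol: "case_nat \<phi> \<pi> \<in> policies (dec_rules M)" "case_nat \<psi> \<pi> \<in> policies (dec_rules M)"
    using \<pi> \<phi> \<psi> by (auto intro: case_nat_policies)
  obtain R where R: "\<And>\<pi> t x. \<pi> \<in> policies (dec_rules M) \<Longrightarrow> \<bar>exp_reward M \<pi> t $ x\<bar> \<le> R"
    using coefficients_bounded[OF fin] by blast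
  define d where "d = (\<chi> x. (\<Sum>t. diffs (?e \<phi> x) t * \<alpha> ^ t) - (\<Sum>t. diffs (?e \<psi> x) t * \<alpha> ^ t))"
  have "((\<lambda>\<beta>. v M (case_nat \<phi> \<pi>) \<beta> - v M (case_nat \<psi> \<pi>) \<beta>) has_vector_derivative d) (at \<alpha>)"
    by (rule has_vector_derivative_vecI, unfold vector_minus_component d_def vec_lambda_beta)
       (intro DERIV_diff v_has_derivative fin pol \<alpha>)
  then have "dv_diff M \<alpha> \<phi> \<psi> \<pi> = d"
    unfolding dv_diff_def by (rule vector_derivative_at)
  moreover have "d $ x = (\<Sum>t. diffs (?e \<phi> x) t * \<alpha> ^ t - diffs (?e \<psi> x) t * \<alpha> ^ t)"
    unfolding d_def vec_lambda_beta
    by (intro suminf_diff summable_diffs_bounded_power_series[OF R \<alpha>] pol)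
  ultimately show ?thesis
    by (simp add: diffs_def algebra_simps)
qed

text \<open>Condition B only controls infinite-horizon policies with rules in \<open>D_opt M \<alpha>\<close>. The first
  decisions of an optimal finite-horizon policy are such rules, and by discounting the later ones
  hardly affect the derivative at \<open>\<alpha>\<close>.\<close>

lemma eventually_not_in_D_fin:
  assumes \<alpha>: "0 < \<alpha>" "\<alpha> < 1" and S: "\<alpha> \<notin> S"
    and sg: "\<bar>sg\<bar> = 1" "\<And>\<beta>. \<beta> \<in> S \<Longrightarrow> \<beta> - \<alpha> = sg * \<bar>\<beta> - \<alpha>\<bar>"
    and K: "\<And>n. n \<ge> K \<Longrightarrow> D_fin M \<alpha> n = D_opt M \<alpha>"
    and \<phi>: "\<phi> \<in> D_opt M \<alpha>" and \<psi>: "\<psi> \<in> D_opt M \<alpha>"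
    and c: "c > 0" "\<And>\<pi>. \<pi> \<in> policies (D_opt M \<alpha>) \<Longrightarrow> c \<le> sg * dv_diff M \<alpha> \<phi> \<psi> \<pi> $ x"
  shows "\<exists>N. \<forall>\<^sub>F \<beta> in at \<alpha> within S. \<forall>n\<ge>N. \<psi> \<notin> D_fin M \<beta> (Suc n)"
proof -
  have dec: "D_opt M \<alpha> \<subseteq> dec_rules M" by (auto simp: D_opt_def)
  have D_dec: "D_fin M \<beta> n \<subseteq> dec_rules M" for \<beta> n by (auto simp: D_fin_def)
  have \<phi>\<psi>: "\<phi> \<in> dec_rules M" "\<psi> \<in> dec_rules M" using \<phi> \<psi> dec by auto
  have \<alpha>1: "\<bar>\<alpha>\<bar> < 1" using \<alpha> by simp
  obtain R where R0: "R \<ge> 0"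
    and Re: "\<And>\<pi> t x. \<pi> \<in> policies (dec_rules M) \<Longrightarrow> \<bar>exp_reward M \<pi> t $ x\<bar> \<le> R"
    and Rh: "\<And>\<pi> n t x. \<pi> \<in> policies (dec_rules M) \<Longrightarrow> \<bar>horizon_coeff M \<pi> n t $ x\<bar> \<le> R"
    using coefficients_bounded[OF fin] by blast
  define \<rho> where "\<rho> = (1 + \<alpha>) / 2"
  have \<rho>: "0 \<le> \<rho>" "\<rho> < 1" "\<alpha> < \<rho>" using \<alpha> by (auto simp: \<rho>_def)
  obtain C where C: "C \<ge> 0" "\<forall>a R y z. (\<forall>t. \<bar>a t\<bar> \<le> R) \<longrightarrow> \<bar>y\<bar> \<le> \<rho> \<longrightarrow> \<bar>z\<bar> \<le> \<rho> \<longrightarrow>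
    \<bar>(\<Sum>t. a t * y ^ t) - (\<Sum>t. a t * z ^ t) - (y - z) * (\<Sum>t. diffs a t * z ^ t)\<bar>
      \<le> R * C * (y - z)\<^sup>2"
    using power_series_quadratic_remainder[OF \<rho>(1,2)] by blast
  \<comment> \<open>Chosen so that the truncation error \<open>2 * R * \<epsilon>\<close> costs at
    most half of \<open>c\<close>; the summand 1 covers \<open>R = 0\<close>.\<close>
  define \<epsilon> where "\<epsilon> = c / (2 * (2 * R + 1))"
  have \<epsilon>: "\<epsilon> > 0" "2 * R * \<epsilon> \<le> c / 2"
    using c(1) R0 by (auto simp: \<epsilon>_def field_simps)
  obtain k where k: "\<forall>a b R. (\<forall>t. \<bar>a t\<bar> \<le> R) \<longrightarrow> (\<forall>t. \<bar>b t\<bar> \<le> R) \<longrightarrow> (\<forall>t\<le>k. a t = b t) \<longrightarrow>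
    \<bar>(\<Sum>t. diffs a t * \<alpha> ^ t) - (\<Sum>t. diffs b t * \<alpha> ^ t)\<bar> \<le> R * \<epsilon>"
    using diffs_power_series_tail[of \<alpha> \<epsilon>] \<alpha> \<epsilon>(1) by auto
  obtain N0 where N0: "\<forall>\<^sub>F \<beta> in at \<alpha>. \<forall>n\<ge>N0. D_fin M \<beta> (Suc n) \<subseteq> D_opt M \<alpha>"
    using D_fin_eventually_optimal[OF fin \<alpha>] by blast
  \<comment> \<open>From stage \<open>L\<close> on, greedy rules near \<open>\<alpha>\<close> are
    optimal at \<open>\<alpha>\<close> by the choice of \<open>N0\<close>, and the greedy rules at
    \<open>\<alpha>\<close> are the optimal ones by Condition A.\<close>
  define L where "L = max N0 K"
  have "\<forall>\<^sub>F \<beta> in at \<alpha>. \<forall>n\<in>{..<L}. D_fin M \<beta> (Suc n) \<subseteq> D_fin M \<alpha> (Suc n)"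
    by (intro eventually_ball_finite ballI D_fin_eventually_subset fin) simp
  moreover have "\<forall>\<^sub>F \<beta> in at \<alpha>. \<bar>\<beta>\<bar> < \<rho>"
    by (rule order_tendstoD(2)[OF tendsto_rabs[OF tendsto_ident_at]]) (use \<alpha> \<rho> in simp)
  moreover have "\<forall>\<^sub>F \<beta> in at \<alpha>. \<bar>\<beta> - \<alpha>\<bar> * (2 * R * C) < c / 2"
  proof (rule order_tendstoD(2))
    show "((\<lambda>\<beta>. \<bar>\<beta> - \<alpha>\<bar> * (2 * R * C)) \<longlongrightarrow> \<bar>\<alpha> - \<alpha>\<bar> * (2 * R * C)) (at \<alpha>)"
      by (intro tendsto_intros)
    show "\<bar>\<alpha> - \<alpha>\<bar> * (2 * R * C) < c / 2" using c(1) by simp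
  qed
  ultimately have ev: "\<forall>\<^sub>F \<beta> in at \<alpha>. (\<forall>n\<in>{..<L}. D_fin M \<beta> (Suc n) \<subseteq> D_fin M \<alpha> (Suc n)) \<and>
      (\<forall>n\<ge>N0. D_fin M \<beta> (Suc n) \<subseteq> D_opt M \<alpha>) \<and> \<bar>\<beta>\<bar> < \<rho> \<and> \<bar>\<beta> - \<alpha>\<bar> * (2 * R * C) < c / 2"
    using N0 by eventually_elim blast
  have "\<psi> \<notin> D_fin M \<beta> (Suc n)"
    if \<beta>: "\<beta> \<in> S" "\<bar>\<beta>\<bar> < \<rho>" "\<bar>\<beta> - \<alpha>\<bar> * (2 * R * C) < c / 2"
      and low: "\<forall>n\<in>{..<L}. D_fin M \<beta> (Suc n) \<subseteq> D_fin M \<alpha> (Suc n)"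
      and high: "\<forall>n\<ge>N0. D_fin M \<beta> (Suc n) \<subseteq> D_opt M \<alpha>"
      and n: "n \<ge> L + k + 1" for \<beta> n
  proof -
    \<comment> \<open>Finitely many early stages are handled by continuity; later ones by Condition
      A, since there the greedy rules at \<open>\<beta>\<close> lie in
      \<open>D_opt M \<alpha> = D_fin M \<alpha> (Suc m)\<close>.\<close>
    have D_sub: "D_fin M \<beta> (Suc m) \<subseteq> D_fin M \<alpha> (Suc m)" for m
    proof (cases "m < L")
      case True
      then show ?thesis using low by simp
    next
      case False
      then show ?thesis using high K[of "Suc m"] by (simp add: L_def)
    qed
    \<comment> \<open>A greedy \<open>n\<close>-stage policy at \<open>\<beta>\<close>, and by
      \<open>D_sub\<close> also at \<open>\<alpha>\<close>; the value \<open>\<phi>\<close> from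
      time \<open>n\<close> on only completes it to an infinite policy.\<close>
    define \<sigma> where "\<sigma> = (\<lambda>i. if i < n then SOME d. d \<in> D_fin M \<beta> (n - i) else \<phi>)"
    have \<sigma>: "\<sigma> i \<in> D_fin M \<beta> (n - i)" if "i < n" for i
      using D_fin_nonempty[OF fin, of \<beta> "n - Suc i"] that
      by (simp add: \<sigma>_def Suc_diff_Suc some_in_eq)
    have \<sigma>\<alpha>: "\<sigma> i \<in> D_fin M \<alpha> (n - i)" if "i < n" for i
      using \<sigma>[OF that] D_sub[of "n - Suc i"] that by (auto simp: Suc_diff_Suc)
    have "\<sigma> i \<in> dec_rules M" for i
      using \<sigma>[of i] D_dec \<phi>\<psi> by (cases "i < n") (auto simp: \<sigma>_def)
    then have \<sigma>_pol: "\<sigma> \<in> policies (dec_rules M)"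
      by (simp add: policies_def)
    \<comment> \<open>Since \<open>\<sigma>\<close> is greedy at both discount factors, the same
      coefficients express the gain of \<open>\<phi>\<close> over \<open>\<psi>\<close> at
      \<open>\<alpha>\<close> and at \<open>\<beta>\<close>.\<close>
    define e where "e = (\<lambda>t. horizon_coeff M (case_nat \<phi> \<sigma>) (Suc n) t $ x -
        horizon_coeff M (case_nat \<psi> \<sigma>) (Suc n) t $ x)"
    have e_le: "\<forall>t. \<bar>e t\<bar> \<le> 2 * R"
    proof
      fix t
      show "\<bar>e t\<bar> \<le> 2 * R"
        using Rh[OF case_nat_policies[OF \<phi>\<psi>(1) \<sigma>_pol], of "Suc n" t x]
          Rh[OF case_nat_policies[OF \<phi>\<psi>(2) \<sigma>_pol], of "Suc n" t x]
        unfolding e_def by linarith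
    qed
    have g: "(\<Sum>t. e t * \<gamma> ^ t) =
        T_op M \<gamma> \<phi> (V_fin M \<gamma> n) $ x - T_op M \<gamma> \<psi> (V_fin M \<gamma> n) $ x"
      if V: "V_fin M \<gamma> n = (\<Sum>t\<le>n. \<gamma> ^ t *\<^sub>R horizon_coeff M \<sigma> n t)" for \<gamma>
    proof -
      have "(\<Sum>t. e t * \<gamma> ^ t) = (\<Sum>t\<le>Suc n. e t * \<gamma> ^ t)"
        by (rule suminf_finite) (auto simp: e_def horizon_coeff_def)
      then show ?thesis
        unfolding V T_op_horizon sum_component e_def
        by (simp add: left_diff_distrib right_diff_distrib sum_subtractf mult.commute del: sum.atMost_Suc)
    qed
    \<comment> \<open>Condition A makes both rules greedy at \<open>\<alpha>\<close>, so the
      constant term of the expansion around \<open>\<alpha>\<close> vanishes.\<close>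
    have "\<phi> \<in> D_fin M \<alpha> (Suc n)" "\<psi> \<in> D_fin M \<alpha> (Suc n)"
      using K[of "Suc n"] n \<phi> \<psi> by (auto simp: L_def)
    then have "T_op M \<alpha> \<phi> (V_fin M \<alpha> n) = T_op M \<alpha> \<psi> (V_fin M \<alpha> n)"
      by (simp add: D_fin_def del: V_fin.simps)
    then have g\<alpha>: "(\<Sum>t. e t * \<alpha> ^ t) = 0"
      using g[OF V_fin_horizon[OF \<sigma>\<alpha>]] by simp
    have g\<beta>: "(\<Sum>t. e t * \<beta> ^ t) =
        T_op M \<beta> \<phi> (V_fin M \<beta> n) $ x - T_op M \<beta> \<psi> (V_fin M \<beta> n) $ x"
      by (rule g[OF V_fin_horizon[OF \<sigma>]])
    define G where "G = (\<Sum>t. diffs e t * \<alpha> ^ t)"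
    have rem: "\<bar>(\<Sum>t. e t * \<beta> ^ t) - (\<beta> - \<alpha>) * G\<bar> \<le> 2 * R * C * (\<beta> - \<alpha>)\<^sup>2"
      using C(2)[rule_format, of e "2 * R" \<beta> \<alpha>] e_le \<beta>(2) \<alpha> \<rho>(3) g\<alpha> by (simp add: G_def)
    \<comment> \<open>Keeps the rules of \<open>\<sigma>\<close> while more than \<open>L\<close>
      stages remain, which are optimal at \<open>\<alpha>\<close>, and replaces the rest by
      \<open>\<phi>\<close>. Condition B thus applies to \<open>\<pi>\<close>.\<close>
    define \<pi> where "\<pi> = (\<lambda>i. if i + L < n then \<sigma> i else \<phi>)"
    have "\<pi> i \<in> D_opt M \<alpha>" for i
    proof (cases "i + L < n")
      case True
      then have "D_fin M \<beta> (Suc (n - Suc i)) \<subseteq> D_opt M \<alpha>"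
        using high by (auto simp: L_def)
      with True \<sigma>[of i] show ?thesis
        by (auto simp: \<pi>_def Suc_diff_Suc)
    qed (simp add: \<pi>_def \<phi>)
    then have \<pi>: "\<pi> \<in> policies (D_opt M \<alpha>)"
      by (simp add: policies_def)
    then have \<pi>_pol: "\<pi> \<in> policies (dec_rules M)"
      using dec by (auto simp: policies_def)
    define b where "b = (\<lambda>t. exp_reward M (case_nat \<phi> \<pi>) t $ x - exp_reward M (case_nat \<psi> \<pi>) t $ x)"
    have b_le: "\<forall>t. \<bar>b t\<bar> \<le> 2 * R"
    proof
      fix t
      show "\<bar>b t\<bar> \<le> 2 * R"
        using Re[OF case_nat_policies[OF \<phi>\<psi>(1) \<pi>_pol], of t x]
          Re[OF case_nat_policies[OF \<phi>\<psi>(2) \<pi>_pol], of t x]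
        unfolding b_def by linarith
    qed
    \<comment> \<open>After prefixing, time \<open>t \<le> k\<close> involves
      \<open>\<sigma>\<close> only at indices below \<open>k\<close>, where
      \<open>n \<ge> L + k + 1\<close> makes \<open>\<sigma>\<close> and \<open>\<pi>\<close>
      agree.\<close>
    have eb: "\<forall>t\<le>k. e t = b t"
    proof (intro allI impI)
      fix t assume t: "t \<le> k"
      have "exp_reward M (case_nat \<xi> \<sigma>) t = exp_reward M (case_nat \<xi> \<pi>) t" for \<xi>
        by (rule exp_reward_cong) (use t n in \<open>auto simp: \<pi>_def split: nat.split\<close>)
      then show "e t = b t"
        using t n by (simp add: e_def b_def horizon_coeff_def)
    qed
    have "\<bar>G - (\<Sum>t. diffs b t * \<alpha> ^ t)\<bar> \<le> 2 * R * \<epsilon>"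
      unfolding G_def using k[rule_format, of e "2 * R" b] e_le b_le eb by blast
    then have "\<bar>sg * G - sg * (\<Sum>t. diffs b t * \<alpha> ^ t)\<bar> \<le> c / 2"
      using \<epsilon>(2) sg(1) by (simp add: abs_mult flip: right_diff_distrib)
    moreover have "c \<le> sg * (\<Sum>t. diffs b t * \<alpha> ^ t)"
      using c(2)[OF \<pi>] unfolding dv_diff_nth[OF \<pi>_pol \<phi>\<psi> \<alpha>1] b_def .
    ultimately have sgG: "c / 2 \<le> sg * G" by linarith
    have h: "\<bar>\<beta> - \<alpha>\<bar> > 0" using \<beta>(1) S by auto
    \<comment> \<open>For \<open>\<beta>\<close> this close to \<open>\<alpha>\<close>, the
      quadratic remainder is smaller than the linear term, whose sign is fixed by Condition B and by
      the side on which \<open>\<beta>\<close> lies.\<close>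
    have "2 * R * C * (\<beta> - \<alpha>)\<^sup>2 = \<bar>\<beta> - \<alpha>\<bar> * (\<bar>\<beta> - \<alpha>\<bar> * (2 * R * C))"
      by (simp add: power2_eq_square mult_ac flip: abs_mult)
    also have "\<dots> < \<bar>\<beta> - \<alpha>\<bar> * (c / 2)"
      using \<beta>(3) h by (rule mult_strict_left_mono)
    also have "\<dots> \<le> \<bar>\<beta> - \<alpha>\<bar> * (sg * G)"
      using sgG by (intro mult_left_mono) auto
    also have "\<dots> = (\<beta> - \<alpha>) * G"
      by (subst (2) sg(2)[OF \<beta>(1)]) simp
    finally have "(\<Sum>t. e t * \<beta> ^ t) > 0"
      using rem by linarith
    then have "T_op M \<beta> \<psi> (V_fin M \<beta> n) $ x < V_fin M \<beta> (Suc n) $ x"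
      using g\<beta> V_fin_Suc_ge[OF fin \<phi>\<psi>(1), of \<beta> n x] by linarith
    then show ?thesis
      using not_in_D_fin[OF fin \<phi>\<psi>(2)] by blast
  qed
  then have "\<forall>\<^sub>F \<beta> in at \<alpha> within S. \<forall>n\<ge>L + k + 1. \<psi> \<notin> D_fin M \<beta> (Suc n)"
    using ev unfolding eventually_at_filter by (auto elim!: eventually_mono)
  then show ?thesis ..
qed

text \<open>Both sides at once: \<open>sg\<close> is the sign of \<open>\<beta> - \<alpha>\<close>
  on \<open>S\<close>, and the strict bound of Condition B appears as a uniform margin
  \<open>c\<close>. Late greedy rules are optimal at \<open>\<alpha>\<close>, those outside
  \<open>D\<close> are excluded, and those in \<open>D\<close> are optimal near
  \<open>\<alpha>\<close> on the side \<open>S\<close>.\<close>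

lemma turnpike_eventually_bounded:
  assumes \<alpha>: "0 < \<alpha>" "\<alpha> < 1" and S: "convex S" "\<alpha> \<notin> S" "at \<alpha> within S \<noteq> bot"
    and sg: "\<bar>sg\<bar> = 1" "\<And>\<beta>. \<beta> \<in> S \<Longrightarrow> \<beta> - \<alpha> = sg * \<bar>\<beta> - \<alpha>\<bar>"
    and A: "condition_A M \<alpha>"
    and D: "D = {\<phi>. \<exists>\<^sub>F \<beta> in at \<alpha> within S. \<phi> \<in> D_opt M \<beta>}"
    and B: "\<forall>\<phi>\<in>D. \<forall>\<psi>\<in>D_opt M \<alpha> - D. \<exists>x. \<exists>c>0. \<forall>\<pi>\<in>policies (D_opt M \<alpha>).
      c \<le> sg * dv_diff M \<alpha> \<phi> \<psi> \<pi> $ x"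
  shows "\<exists>N. \<forall>\<^sub>F \<beta> in at \<alpha> within S. turnpike M \<beta> \<le> N"
proof -
  obtain K where K: "\<And>n. n \<ge> K \<Longrightarrow> D_fin M \<alpha> n = D_opt M \<alpha>"
    using A by (auto simp: condition_A_def)
  have finD: "finite A" if "A \<subseteq> dec_rules M" for A
    using finite_dec_rules[OF fin] that by (rule finite_subset[rotated])
  have D_dec: "D \<subseteq> dec_rules M"
    unfolding D using frequently_ex by (fastforce simp: D_opt_def)
  \<comment> \<open>A pigeonhole argument: every \<open>\<beta>\<close> has an optimal rule among
    finitely many, so some rule recurs arbitrarily close to \<open>\<alpha>\<close>.\<close>
  have "D \<noteq> {}"
  proof
    assume "D = {}"
    then have "\<forall>\<^sub>F \<beta> in at \<alpha> within S. \<forall>\<phi>\<in>dec_rules M. \<phi> \<notin> D_opt M \<beta>"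
      using D by (intro eventually_ball_finite finite_dec_rules[OF fin]) (auto simp: frequently_def)
    moreover have "\<forall>\<^sub>F \<beta> in at \<alpha> within S. 0 < \<beta>" "\<forall>\<^sub>F \<beta> in at \<alpha> within S. \<beta> < 1"
      by (rule order_tendstoD[OF tendsto_ident_at], use \<alpha> in simp)+
    ultimately have "\<forall>\<^sub>F \<beta> in at \<alpha> within S. False"
    proof eventually_elim
      case (elim \<beta>)
      then show ?case
        using optimality_equation(1)[OF fin, of \<beta>] by (auto simp: D_opt_def)
    qed
    then show False using S(3) by simp
  qed
  then obtain \<phi> where \<phi>: "\<phi> \<in> D" by blast
  then have "\<exists>\<^sub>F \<beta> in at \<alpha>. \<phi> \<in> D_opt M \<beta>"
    unfolding D frequently_def using filter_leD[OF at_le[OF subset_UNIV]] by blast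
  then have \<phi>\<alpha>: "\<phi> \<in> D_opt M \<alpha>"
    by (rule frequently_optimal_imp_optimal[OF fin \<alpha>])
  \<comment> \<open>The single rule \<open>\<phi>\<close> fixed above serves as the better
    alternative to every \<open>\<psi>\<close>.\<close>
  have "\<exists>N. \<forall>\<^sub>F \<beta> in at \<alpha> within S. \<forall>n\<ge>N. \<psi> \<notin> D_fin M \<beta> (Suc n)"
    if \<psi>: "\<psi> \<in> D_opt M \<alpha> - D" for \<psi>
  proof -
    from B \<phi> \<psi> obtain x c where "c > 0"
      "\<forall>\<pi>\<in>policies (D_opt M \<alpha>). c \<le> sg * dv_diff M \<alpha> \<phi> \<psi> \<pi> $ x" by blast
    then show ?thesis
      using \<psi> by (intro eventually_not_in_D_fin[OF \<alpha> S(2) sg K \<phi>\<alpha>, where c = c and x = x]) auto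
  qed
  moreover have "finite (D_opt M \<alpha> - D)"
    by (rule finD) (auto simp: D_opt_def)
  ultimately obtain N1 where
    N1: "\<forall>\<^sub>F \<beta> in at \<alpha> within S. \<forall>n\<ge>N1. \<forall>\<psi>\<in>D_opt M \<alpha> - D. \<psi> \<notin> D_fin M \<beta> (Suc n)"
    using eventually_finite_uniform_threshold[of "D_opt M \<alpha> - D"
        "\<lambda>\<psi> \<beta> n. \<psi> \<notin> D_fin M \<beta> (Suc n)" "at \<alpha> within S"] by blast
  obtain N0 where "\<forall>\<^sub>F \<beta> in at \<alpha>. \<forall>n\<ge>N0. D_fin M \<beta> (Suc n) \<subseteq> D_opt M \<alpha>"
    using D_fin_eventually_optimal[OF fin \<alpha>] by blast
  then have "\<forall>\<^sub>F \<beta> in at \<alpha> within S. \<forall>n\<ge>N0. D_fin M \<beta> (Suc n) \<subseteq> D_opt M \<alpha>"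
    by (rule filter_leD[OF at_le[OF subset_UNIV]])
  moreover have "\<forall>\<^sub>F \<beta> in at \<alpha> within S. \<forall>\<phi>\<in>D. \<phi> \<in> D_opt M \<beta>"
    by (intro eventually_ball_finite finD D_dec ballI
        frequently_optimal_imp_eventually_optimal[OF fin \<alpha> S(1,2)]) (simp add: D)
  ultimately have "\<forall>\<^sub>F \<beta> in at \<alpha> within S. turnpike M \<beta> \<le> Suc (N0 + N1)"
    using N1
  proof eventually_elim
    case (elim \<beta>)
    show ?case
    proof (rule turnpike_le, intro allI impI subsetI)
      fix n \<psi> assume "N0 + N1 \<le> n" "\<psi> \<in> D_fin M \<beta> (Suc n)"
      moreover from this have "\<psi> \<in> D_opt M \<alpha>"
        using elim(1) by (meson add_leD1 subsetD)
      moreover have "N1 \<le> n" using \<open>N0 + N1 \<le> n\<close> by simp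
      ultimately show "\<psi> \<in> D_opt M \<beta>"
        using elim(2,3) by blast
    qed
  qed
  then show ?thesis ..
qed

end

section \<open>The left and right cases\<close>

theorem theorem5p2:
  fixes M :: "('x::finite, 'a) mdp" and \<alpha> :: real
  assumes "finite_mdp M"
    and "\<alpha> \<in> {0<..<1}"
    and "irregular M \<alpha>"
  shows "(condition_A M \<alpha> \<and> condition_B_minus M \<alpha> \<longrightarrow>
            (\<exists>\<delta>>0. {\<alpha> - \<delta> <..< \<alpha>} \<subseteq> {0..<1} \<and> turnpike_sup M {\<alpha> - \<delta> <..< \<alpha>} < \<infinity>)) \<and>
         (condition_A M \<alpha> \<and> condition_B_plus M \<alpha> \<longrightarrow>
            (\<exists>\<delta>>0. {\<alpha> <..< \<alpha> + \<delta>} \<subseteq> {0..<1} \<and> turnpike_sup M {\<alpha> <..< \<alpha> + \<delta>} < \<infinity>))"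
proof (intro conjI impI; elim conjE)
  have \<alpha>: "0 < \<alpha>" "\<alpha> < 1" using assms(2) by auto
  assume A: "condition_A M \<alpha>" and B: "condition_B_minus M \<alpha>"
  have eq: "{\<alpha> - 1 / real i<..<\<alpha>} = {\<beta> \<in> {..<\<alpha>}. dist \<beta> \<alpha> < 1 / real i}" for i
    by (auto simp: dist_real_def)
  have D: "D_minus M \<alpha> = {\<phi>. \<exists>\<^sub>F \<beta> in at \<alpha> within {..<\<alpha>}. \<phi> \<in> D_opt M \<beta>}"
    unfolding D_minus_def eq by (rule Inter_D_set_eq_frequently[OF \<alpha>]) simp
  have "\<exists>x. \<exists>c>0. \<forall>\<pi>\<in>policies (D_opt M \<alpha>). c \<le> - 1 * dv_diff M \<alpha> \<phi> \<psi> \<pi> $ x"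
    if "\<phi> \<in> D_minus M \<alpha>" "\<psi> \<in> D_opt M \<alpha> - D_minus M \<alpha>" for \<phi> \<psi>
  proof -
    from B that obtain x where
      "(SUP \<pi>\<in>policies (D_opt M \<alpha>). ereal (dv_diff M \<alpha> \<phi> \<psi> \<pi> $ x)) < 0"
      unfolding condition_B_minus_def by blast
    \<comment> \<open>A real number strictly between the supremum and 0 yields the uniform margin
      \<open>c = - z\<close>, also when the supremum is minus infinity.\<close>
    then obtain z where
      z: "(SUP \<pi>\<in>policies (D_opt M \<alpha>). ereal (dv_diff M \<alpha> \<phi> \<psi> \<pi> $ x)) < ereal z" "ereal z < 0"
      using ereal_dense2 by blast
    have "ereal (dv_diff M \<alpha> \<phi> \<psi> \<pi> $ x) < ereal z" if "\<pi> \<in> policies (D_opt M \<alpha>)" for \<pi>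
      using SUP_upper[OF that] z(1) by (rule le_less_trans)
    then show ?thesis
      using z(2) by (intro exI[of _ x] exI[of _ "- z"]) (auto intro: less_imp_le)
  qed
  then have "\<exists>N. \<forall>\<^sub>F \<beta> in at \<alpha> within {..<\<alpha>}. turnpike M \<beta> \<le> N"
    by (intro turnpike_eventually_bounded[OF assms(1) \<alpha> _ _ _ _ _ A D, where sg = "- 1"]) auto
  then obtain N where N: "\<forall>\<^sub>F \<beta> in at \<alpha> within {..<\<alpha>}. turnpike M \<beta> \<le> N" ..
  obtain \<delta> where \<delta>: "\<delta> > 0" "{\<alpha> - \<delta><..<\<alpha> + \<delta>} \<subseteq> {0..<1}"
    "\<And>E. E \<subseteq> {..<\<alpha>} \<inter> {\<alpha> - \<delta><..<\<alpha> + \<delta>} \<Longrightarrow> turnpike_sup M E < \<infinity>"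
    using turnpike_sup_finite[OF \<alpha> N] by blast
  moreover have "{\<alpha> - \<delta><..<\<alpha>} \<subseteq> {..<\<alpha>} \<inter> {\<alpha> - \<delta><..<\<alpha> + \<delta>}"
    using \<delta>(1) by auto
  ultimately show "\<exists>\<delta>>0. {\<alpha> - \<delta> <..< \<alpha>} \<subseteq> {0..<1} \<and> turnpike_sup M {\<alpha> - \<delta> <..< \<alpha>} < \<infinity>"
    by (intro exI[of _ \<delta>]) blast
next
  have \<alpha>: "0 < \<alpha>" "\<alpha> < 1" using assms(2) by auto
  assume A: "condition_A M \<alpha>" and B: "condition_B_plus M \<alpha>"
  have eq: "{\<alpha><..<\<alpha> + 1 / real i} = {\<beta> \<in> {\<alpha><..}. dist \<beta> \<alpha> < 1 / real i}" for i
    by (auto simp: dist_real_def)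
  have D: "D_plus M \<alpha> = {\<phi>. \<exists>\<^sub>F \<beta> in at \<alpha> within {\<alpha><..}. \<phi> \<in> D_opt M \<beta>}"
    unfolding D_plus_def eq by (rule Inter_D_set_eq_frequently[OF \<alpha>]) simp
  have "\<exists>x. \<exists>c>0. \<forall>\<pi>\<in>policies (D_opt M \<alpha>). c \<le> 1 * dv_diff M \<alpha> \<phi> \<psi> \<pi> $ x"
    if "\<phi> \<in> D_plus M \<alpha>" "\<psi> \<in> D_opt M \<alpha> - D_plus M \<alpha>" for \<phi> \<psi>
  proof -
    from B that obtain x where
      "0 < (INF \<pi>\<in>policies (D_opt M \<alpha>). ereal (dv_diff M \<alpha> \<phi> \<psi> \<pi> $ x))"
      unfolding condition_B_plus_def by blast
    \<comment> \<open>Here the margin is \<open>z\<close> itself; an infimum equal to plus infinity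
      causes no difficulty.\<close>
    then obtain z where
      z: "0 < ereal z" "ereal z < (INF \<pi>\<in>policies (D_opt M \<alpha>). ereal (dv_diff M \<alpha> \<phi> \<psi> \<pi> $ x))"
      using ereal_dense2 by blast
    have "ereal z < ereal (dv_diff M \<alpha> \<phi> \<psi> \<pi> $ x)" if "\<pi> \<in> policies (D_opt M \<alpha>)" for \<pi>
      using z(2) INF_lower[OF that] by (rule less_le_trans)
    then show ?thesis
      using z(1) by (intro exI[of _ x] exI[of _ z]) (auto intro: less_imp_le)
  qed
  then have "\<exists>N. \<forall>\<^sub>F \<beta> in at \<alpha> within {\<alpha><..}. turnpike M \<beta> \<le> N"
    by (intro turnpike_eventually_bounded[OF assms(1) \<alpha> _ _ _ _ _ A D, where sg = 1]) auto
  then obtain N where N: "\<forall>\<^sub>F \<beta> in at \<alpha> within {\<alpha><..}. turnpike M \<beta> \<le> N" ..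
  obtain \<delta> where \<delta>: "\<delta> > 0" "{\<alpha> - \<delta><..<\<alpha> + \<delta>} \<subseteq> {0..<1}"
    "\<And>E. E \<subseteq> {\<alpha><..} \<inter> {\<alpha> - \<delta><..<\<alpha> + \<delta>} \<Longrightarrow> turnpike_sup M E < \<infinity>"
    using turnpike_sup_finite[OF \<alpha> N] by blast
  moreover have "{\<alpha><..<\<alpha> + \<delta>} \<subseteq> {\<alpha><..} \<inter> {\<alpha> - \<delta><..<\<alpha> + \<delta>}"
    using \<delta>(1) by auto
  ultimately show "\<exists>\<delta>>0. {\<alpha> <..< \<alpha> + \<delta>} \<subseteq> {0..<1} \<and> turnpike_sup M {\<alpha> <..< \<alpha> + \<delta>} < \<infinity>"
    by (intro exI[of _ \<delta>]) blast
qed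

end
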